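(* Let $(\mathcal{H},X,G,k,\mu,d)$ be a Berezin quantization. Suppose there exist $w:X\to(0,\infty)$ and $M>0$ such that (i) $\displaystyle w(y)^{-1}\int_X |\langle k_x,k_y\rangle|\, w(x)\,d\mu(x)\le M$ for all $y\in X$; (ii) $\displaystyle \lim_{R\to\infty}\sup_{y\in X} w(y)^{-1}\int_{B(y,R)^c}|\langle k_x,k_y\rangle|\, w(x)\,d\mu(x)=0$. Suppose also that $G_\tau$ contains an Abelian subgroup which has an accumulation point at $1$ and no nontrivial compact subgroups. Then, if $\sigma:X\to[0,1]$ is thin, there exists $c>0$ such that $$\langle T_{1-\sigma}f,f\rangle\ge c\|f\|^2\quad\text{for all } f\in\mathcal{H}.$$
   Context: A Berezin quantization $(\mathcal{H},X,G,k,\mu,d)$ consists of the following. $\mathcal{H}$ is a Hilbert space. $(X,d,\mu)$ is a metric measure space with metric $d$ and Borel measure $\mu$, where $d$ is proper (every ball is precompact). $k:X\to\mathcal{H}$, $x\mapsto k_x$, is a continuous map such that $\{k_x\}_{x\in X}$ is a normalized continuous Parseval frame for $\mathcal{H}$, meaning that $f=\int_X\langle f,k_x\rangle k_x\,d\mu(x)$ for every $f\in\mathcal{H}$. $G$ is a locally compact group acting transitively on $X$ so that $\mu(gE)=\mu(E)$, $d(gx,gy)=d(x,y)$ and $|\langle k_{gx},k_{gy}\rangle|=|\langle k_x,k_y\rangle|$ for all $g\in G$, $x,y\in X$ and measurable $E\subset X$. $G_\tau=\{h\in G:\langle k_{hx},k_{hy}\rangle=\langle k_x,k_y\rangle\text{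 for all }x,y\in X\}$, a subgroup of $G$; $1$ is the identity of $G$. $B(y,R)$ is the ball of radius $R$ about $y$ for $d$, and $B(y,R)^c$ is its complement in $X$. For a non-negative, bounded, measurable function $\rho$ on $X$, the Toeplitz operator $T_\rho:\mathcal{H}\to\mathcal{H}$ is $T_\rho f=\int_X\rho(x)\langle f,k_x\rangle k_x\,d\mu(x)$. The notation $y\to\infty$ means $d(z,y)\to\infty$ for some (equivalently all) $z\in X$. A measurable function $\sigma$ on $X$ is thin if its Berezin transform $\tilde\sigma(y)=\int_X\sigma(x)|\langle k_x,k_y\rangle|^2\,d\mu(x)$ tends to $0$ as $y\to\infty$.
   Formalization: The Abelian subgroup A of G_τ is additionally assumed to act properly on X, i.e. (h,x)↦(hx,x) is a proper map A×X→X×X; without this the claim fails, e.g. for X=ℤ, k_n=e_n, G=ℤ×ℝ with ℝ acting trivially, A={0}×ℝ, σ=1_{0}. *)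

theory Defs
  imports "HOL-Analysis.Analysis" "HOL-Algebra.Group_Action" "HOL-Library.Complex_Order"
begin

section \<open>Complex Hilbert spaces\<close>

text \<open>The inner product is linear in the \<^emph>\<open>first\<close> argument. Positive definiteness is not listed
  separately, as it follows from the axiom relating the inner product to the norm.\<close>

class complex_inner = real_normed_vector +
  fixes scaleC :: "complex \<Rightarrow> 'a \<Rightarrow> 'a"  (infixr \<open>*\<^sub>C\<close> 75)
    and cinner :: "'a \<Rightarrow> 'a \<Rightarrow> complex"
  assumes scaleC_add_right: "a *\<^sub>C (x + y) = a *\<^sub>C x + a *\<^sub>C y"
    and scaleC_add_left: "(a + b) *\<^sub>C x = a *\<^sub>C x + b *\<^sub>C x"
    and scaleC_scaleC: "a *\<^sub>C b *\<^sub>C x = (a * b) *\<^sub>C x"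
    and scaleR_scaleC: "r *\<^sub>R x = complex_of_real r *\<^sub>C x"
    and cinner_commute: "cinner x y = cnj (cinner y x)"
    and cinner_add_left: "cinner (x + y) z = cinner x z + cinner y z"
    and cinner_scaleC_left: "cinner (a *\<^sub>C x) y = a * cinner x y"
    and norm_eq_sqrt_cinner: "norm x = sqrt (Re (cinner x x))"

class chilbert_space = complex_inner + banach

text \<open>The Hilbert-space valued integrals occurring for continuous frames converge weakly, but in
  general not absolutely, so that they are not Bochner integrals.\<close>

definition has_weak_integral ::
    "'x measure \<Rightarrow> ('x \<Rightarrow> 'h::chilbert_space) \<Rightarrow> 'h \<Rightarrow> bool" where
  "has_weak_integral M F v \<longleftrightarrow>
     (\<forall>g. integrable M (\<lambda>x. cinner (F x) g) \<and> (\<integral>x. cinner (F x) g \<partial>M) = cinner v g)"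

definition weak_integral :: "'x measure \<Rightarrow> ('x \<Rightarrow> 'h::chilbert_space) \<Rightarrow> 'h" where
  "weak_integral M F = (THE v. has_weak_integral M F v)"


section \<open>Locally compact groups and their actions\<close>

locale topological_group = group G for G (structure) +
  fixes T :: "'g topology"
  assumes topspace_eq: "topspace T = carrier G"
    and continuous_mult: "continuous_map (prod_topology T T) T (\<lambda>(g, h). g \<otimes> h)"
    and continuous_inv: "continuous_map T T (\<lambda>g. inv g)"

locale locally_compact_group = topological_group +
  assumes locally_compact: "locally_compact_space T"

text \<open>A set \<open>A\<close> of group elements acts properly if \<open>(h, x) \<mapsto> (h x, x)\<close> is a proper map on the product
  of \<open>A\<close> with the space acted upon. Compactness in the group carries no information about the
  orbits without such a condition: a group without nontrivial compact subgroups may act trivially, or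
  with all orbits relatively compact.\<close>

definition acts_properly ::
    "'g topology \<Rightarrow> ('g \<Rightarrow> 'x::topological_space \<Rightarrow> 'x) \<Rightarrow> 'g set \<Rightarrow> bool" where
  "acts_properly T \<phi> A \<longleftrightarrow>
     proper_map (prod_topology (subtopology T A) euclidean) (prod_topology euclidean euclidean)
       (\<lambda>(h, x). (\<phi> h x, x))"


section \<open>Berezin quantizations\<close>

text \<open>The Hilbert space and the metric space are the types \<open>'h\<close> and \<open>'x\<close>; \<open>\<phi> g x\<close> is the action of
  the group element \<open>g\<close> on the point \<open>x\<close>.\<close>

locale berezin_quantization =
  locally_compact_group G T + transitive_action G UNIV \<phi>
  for G (structure) and T and \<phi> :: "'g \<Rightarrow> 'x::metric_space \<Rightarrow> 'x" +
  fixes \<mu> :: "'x measure" and k :: "'x \<Rightarrow> 'h::chilbert_space"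
  assumes proper_metric: "compact (closure (ball (x::'x) r))"
    and borel_measure: "sets \<mu> = sets borel"
    and continuous_frame: "continuous_on UNIV k"
    and normalized_frame: "norm (k x) = 1"
    and parseval_frame: "has_weak_integral \<mu> (\<lambda>x. cinner f (k x) *\<^sub>C k x) f"
    and continuous_action:
      "continuous_map (prod_topology T euclidean) euclidean (\<lambda>(g, x). \<phi> g x)"
    and measure_invariant:
      "g \<in> carrier G \<Longrightarrow> E \<in> sets \<mu> \<Longrightarrow> emeasure \<mu> (\<phi> g ` E) = emeasure \<mu> E"
    and dist_invariant: "g \<in> carrier G \<Longrightarrow> dist (\<phi> g x) (\<phi> g y) = dist x y"
    and frame_invariant:
      "g \<in> carrier G \<Longrightarrow> cmod (cinner (k (\<phi> g x)) (k (\<phi> g y))) = cmod (cinner (k x) (k y))"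

definition G_tau ::
    "('g, 'm) monoid_scheme \<Rightarrow> ('g \<Rightarrow> 'x \<Rightarrow> 'x) \<Rightarrow> ('x \<Rightarrow> 'h::chilbert_space) \<Rightarrow> 'g set" where
  "G_tau G \<phi> k =
     {h \<in> carrier G. \<forall>x y. cinner (k (\<phi> h x)) (k (\<phi> h y)) = cinner (k x) (k y)}"

definition toeplitz ::
    "'x measure \<Rightarrow> ('x \<Rightarrow> 'h::chilbert_space) \<Rightarrow> ('x \<Rightarrow> real) \<Rightarrow> 'h \<Rightarrow> 'h" where
  "toeplitz \<mu> k \<rho> f =
     weak_integral \<mu> (\<lambda>x. (complex_of_real (\<rho> x) * cinner f (k x)) *\<^sub>C k x)"

definition berezin_transform ::
    "'x measure \<Rightarrow> ('x \<Rightarrow> 'h::chilbert_space) \<Rightarrow> ('x \<Rightarrow> real) \<Rightarrow> 'x \<Rightarrow> real" where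
  "berezin_transform \<mu> k \<sigma> y = (\<integral>x. \<sigma> x * (cmod (cinner (k x) (k y)))\<^sup>2 \<partial>\<mu>)"

text \<open>The integrability requirement only says that the Berezin transform exists; it holds
  automatically if \<open>\<sigma>\<close> is bounded.\<close>

definition thin ::
    "'x::metric_space measure \<Rightarrow> ('x \<Rightarrow> 'h::chilbert_space) \<Rightarrow> ('x \<Rightarrow> real) \<Rightarrow> bool" where
  "thin \<mu> k \<sigma> \<longleftrightarrow>
     \<sigma> \<in> borel_measurable \<mu> \<and>
     (\<forall>y. integrable \<mu> (\<lambda>x. \<sigma> x * (cmod (cinner (k x) (k y)))\<^sup>2)) \<and>
     (\<forall>z. (berezin_transform \<mu> k \<sigma> \<longlongrightarrow> 0) (filtercomap (\<lambda>y. dist z y) at_top))"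

end

theory Submission
  imports Defs "HOL-Complex_Analysis.Great_Picard"
begin

text \<open>Write \<open>form \<rho> f\<close> for the quadratic form \<open>\<langle>T\<^sub>\<rho> f, f\<rangle>\<close>. If \<open>\<rho>\<close> is thin, Schur's test bounds \<open>form \<rho>\<close>
  outside a large ball, so \<open>form \<rho>\<close> is continuous along bounded weakly convergent sequences. Hence, if
  no constant \<open>c\<close> works, there is \<open>f \<noteq> 0\<close> with \<open>form (1 - \<sigma>) f = 0\<close>, and the open set where
  \<open>\<langle>f, k\<^sub>x\<rangle> \<noteq> 0\<close> has a thin indicator. As in the Amrein-Berthier uncertainty principle, such an open
  set \<open>S\<close> is enlarged to \<open>S \<union> h S\<close> with \<open>h\<close> near the identity, where \<open>h\<close> can be chosen so that the
  space of vectors supported on the set grows strictly. Infinitely many such steps, with summable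
  increments of the Berezin transform, yield a thin open set supporting an infinite-dimensional
  space, which compactness excludes.\<close>

section \<open>Complex Hilbert spaces\<close>

text \<open>Two demands on \<open>h\<close> compete: the gain \<open>h S - S\<close> must be small,
  which forces \<open>h\<close> close to the identity, while the supported space must still grow.
  Openness of \<open>S\<close> gives the smallness: a compact part of \<open>S\<close> stays inside
  \<open>S\<close> under all small translations, so within a bounded region only a remainder of
  small measure can leave. Growth rests on the exact invariance of the inner products under
  \<open>G_tau\<close>: an element \<open>h\<close> then acts on the Hilbert space by an isometry
  carrying vectors supported on \<open>S\<close> to vectors supported on \<open>h S\<close>, and if
  all small \<open>h\<close> in the Abelian subgroup \<open>A\<close> kept the space fixed, they
  would generate a compactness that \<open>A\<close> does not admit.

  A thin set is not assumed to have finite measure, so the Hilbert-Schmidt bound of the classical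
  argument is not at hand. The Berezin transform, that is \<open>form \<rho> (k y)\<close> taken
  uniformly in \<open>y\<close>, takes over the role of the measure.\<close>

lemma cinner_add_right: "cinner x (y + z) = cinner x y + cinner (x::'a::complex_inner) z"
  by (metis cinner_add_left cinner_commute complex_cnj_add)

lemma cinner_scaleC_right: "cinner x (a *\<^sub>C y) = cnj a * cinner (x::'a::complex_inner) y"
  by (metis cinner_commute cinner_scaleC_left complex_cnj_mult)

lemma cinner_scaleR_left: "cinner (r *\<^sub>R x) y = of_real r * cinner (x::'a::complex_inner) y"
  by (simp add: scaleR_scaleC cinner_scaleC_left)

lemma cinner_scaleR_right: "cinner x (r *\<^sub>R y) = of_real r * cinner (x::'a::complex_inner) y"
  by (simp add: scaleR_scaleC cinner_scaleC_right)

lemma cinner_self: "cinner x x = complex_of_real ((norm (x::'a::complex_inner))\<^sup>2)"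
proof (rule complex_eqI)
  have "0 \<le> Re (cinner x x)"
    by (metis norm_eq_sqrt_cinner norm_ge_zero real_sqrt_ge_0_iff)
  then show "Re (cinner x x) = Re (complex_of_real ((norm x)\<^sup>2))"
    by (simp add: norm_eq_sqrt_cinner[of x])
  show "Im (cinner x x) = Im (complex_of_real ((norm x)\<^sup>2))"
    using cinner_commute[of x x] by (simp add: complex_eq_iff)
qed

lemma cinner_minus_left: "cinner (- x) y = - cinner (x::'a::complex_inner) y"
  using cinner_scaleR_left[of "-1" x y] by simp

lemma cinner_diff_left: "cinner (x - y) z = cinner x z - cinner (y::'a::complex_inner) z"
  using cinner_add_left[of x "- y" z] by (simp add: cinner_minus_left)

lemma cinner_diff_right: "cinner x (y - z) = cinner x y - cinner (x::'a::complex_inner) z"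
  by (metis cinner_commute cinner_diff_left complex_cnj_diff)

lemma cinner_zero_left [simp]: "cinner 0 (x::'a::complex_inner) = 0"
  using cinner_diff_left[of x x x] by simp

lemma cinner_zero_right [simp]: "cinner (x::'a::complex_inner) 0 = 0"
  using cinner_diff_right[of x x x] by simp

lemma norm_scaleC: "norm (a *\<^sub>C x) = cmod a * norm (x::'a::complex_inner)"
proof -
  have "complex_of_real ((norm (a *\<^sub>C x))\<^sup>2) = complex_of_real ((cmod a * norm x)\<^sup>2)"
    unfolding cinner_self[symmetric] cinner_scaleC_left cinner_scaleC_right
    by (simp add: cinner_self power_mult_distrib complex_norm_square del: of_real_power)
  then show ?thesis
    by (simp only: of_real_eq_iff) (simp add: power2_eq_iff_nonneg)
qed

lemma norm_add_sq: "(norm (x + y))\<^sup>2 = (norm x)\<^sup>2 + 2 * Re (cinner x y) + (norm (y::'a::complex_inner))\<^sup>2"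
proof -
  have "complex_of_real ((norm (x + y))\<^sup>2) = cinner x x + cinner x y + cinner y x + cinner y y"
    unfolding cinner_self[symmetric] by (simp add: cinner_add_left cinner_add_right)
  then have "Re (complex_of_real ((norm (x + y))\<^sup>2)) = Re (cinner x x + cinner x y + cinner y x + cinner y y)"
    by simp
  moreover have "Re (cinner y x) = Re (cinner x y)"
    by (subst cinner_commute) simp
  ultimately show ?thesis by (simp add: cinner_self)
qed

lemma norm_diff_sq: "(norm (x - y))\<^sup>2 = (norm x)\<^sup>2 - 2 * Re (cinner x y) + (norm (y::'a::complex_inner))\<^sup>2"
  using norm_add_sq[of x "- y"] cinner_scaleR_right[of x "-1" y] by simp

lemma norm_cinner_le: "cmod (cinner x y) \<le> norm x * norm (y::'a::complex_inner)"
proof (cases "cinner x y = 0")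
  case False
  define c where "c = cinner x y"
  \<comment> \<open>Scaled so that \<open>a *\<^sub>C y\<close> has the norm of \<open>x\<close>,
    with a phase making its inner product with \<open>x\<close> real and nonnegative; expanding the
    squared distance of the two vectors gives the bound.\<close>
  define a where "a = complex_of_real (norm x / norm y) * sgn c"
  have c0: "c \<noteq> 0" using False c_def by simp
  have y0: "norm y > 0" "norm x > 0" using False by auto
  have "cnj (sgn c) * c = complex_of_real (cmod c)"
    using c0 complex_norm_square[of c] by (simp add: sgn_eq field_simps power2_eq_square)
  then have ca: "cnj a * c = of_real (norm x / norm y * cmod c)"
    by (simp add: a_def mult.assoc)
  have na: "norm (a *\<^sub>C y) = norm x"
    using y0 c0 by (simp add: a_def norm_scaleC norm_mult norm_divide norm_sgn)
  have "0 \<le> (norm (x - a *\<^sub>C y))\<^sup>2" by simp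
  also have "\<dots> = (norm x)\<^sup>2 - 2 * (norm x / norm y * cmod c) + (norm x)\<^sup>2"
    unfolding norm_diff_sq na cinner_scaleC_right c_def[symmetric] ca by simp
  finally have "norm x / norm y * cmod c \<le> norm x * norm x" by (simp add: power2_eq_square)
  then show ?thesis using y0 by (simp add: field_simps c_def)
qed simp

lemma bounded_bilinear_cinner: "bounded_bilinear (cinner :: 'a::complex_inner \<Rightarrow> _)"
proof
  show "\<exists>K. \<forall>a b. norm (cinner a b) \<le> norm a * norm (b::'a) * K"
    by (rule exI[of _ 1]) (simp add: norm_cinner_le)
qed (simp_all add: cinner_add_left cinner_add_right cinner_scaleR_left cinner_scaleR_right scaleR_conv_of_real)

text \<open>The representing vector minimises \<open>(norm v)\<^sup>2 - 2 * Re (L v)\<close>; by the parallelogram law,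
  minimising sequences are Cauchy.\<close>

lemma riesz_representation:
  fixes L :: "'a::chilbert_space \<Rightarrow> complex"
  assumes add: "\<And>x y. L (x + y) = L x + L y"
    and scale: "\<And>a x. L (a *\<^sub>C x) = a * L x"
    and bound: "\<And>x. cmod (L x) \<le> C * norm x"
  obtains v where "\<And>x. L x = cinner x v"
proof -
  define J where "J v = (norm v)\<^sup>2 - 2 * Re (L v)" for v
  have L_scaleR: "L (r *\<^sub>R x) = of_real r * L x" for r x
    by (simp add: scaleR_scaleC scale)
  have L_diff: "L (x - y) = L x - L y" for x y
    using add[of x "(-1) *\<^sub>R y"] L_scaleR[of "-1" y] by simp
  have lower: "J v \<ge> - (C\<^sup>2)" for v
  proof -
    have "Re (L v) \<le> C * norm v"
      using complex_Re_le_cmod[of "L v"] bound[of v] by linarith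
    then show ?thesis
      using zero_le_power2[of "norm v - C"] by (simp add: J_def power2_diff mult.commute)
  qed
  then have bdd: "bdd_below (range J)"
    by (auto intro!: bdd_belowI)
  define m where "m = Inf (range J)"
  have m_le: "m \<le> J v" for v
    unfolding m_def by (rule cInf_lower[OF _ bdd]) simp
  have "\<exists>v. J v < m + inverse (real (Suc n))" for n
  proof -
    have "Inf (range J) < m + inverse (real (Suc n))" unfolding m_def by simp
    then show ?thesis
      by (subst (asm) cInf_less_iff[OF _ bdd]) auto
  qed
  then obtain v where v: "\<And>n. J (v n) < m + inverse (real (Suc n))" by metis
  have parallelogram: "(norm (x - y))\<^sup>2 \<le> 2 * (J x - m) + 2 * (J y - m)" for x y
  proof -
    have "4 * J ((1/2) *\<^sub>R (x + y)) = (norm (x + y))\<^sup>2 - 4 * Re (L x) - 4 * Re (L y)"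
      by (simp add: J_def L_scaleR add power_divide) (simp add: field_simps)
    moreover have "(norm (x - y))\<^sup>2 = 2 * (norm x)\<^sup>2 + 2 * (norm y)\<^sup>2 - (norm (x + y))\<^sup>2"
      by (simp add: norm_add_sq norm_diff_sq)
    ultimately have "(norm (x - y))\<^sup>2 = 2 * J x + 2 * J y - 4 * J ((1/2) *\<^sub>R (x + y))"
      by (simp add: J_def)
    then show ?thesis using m_le[of "(1/2) *\<^sub>R (x + y)"] by simp
  qed
  have "Cauchy v"
  proof (rule metric_CauchyI)
    fix e :: real assume "e > 0"
    then obtain N where N: "inverse (real (Suc N)) < e\<^sup>2 / 4"
      using reals_Archimedean[of "e\<^sup>2 / 4"] by auto
    have small: "J (v n) - m < e\<^sup>2 / 4" if "n \<ge> N" for n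
    proof -
      have "inverse (real (Suc n)) \<le> inverse (real (Suc N))"
        using that by (simp add: field_simps)
      then show ?thesis using v[of n] N by linarith
    qed
    have "dist (v i) (v j) < e" if "i \<ge> N" "j \<ge> N" for i j
    proof -
      have "(norm (v i - v j))\<^sup>2 < e\<^sup>2"
        using parallelogram[of "v i" "v j"] small[OF that(1)] small[OF that(2)] by argo
      then show ?thesis
        using \<open>e > 0\<close> by (simp add: dist_norm power_less_imp_less_base)
    qed
    then show "\<exists>N. \<forall>i\<ge>N. \<forall>j\<ge>N. dist (v i) (v j) < e" by blast
  qed
  then obtain u where u: "v \<longlonglongrightarrow> u"
    using Cauchy_convergent_iff convergent_def by blast
  have "bounded_linear L"
    by (rule bounded_linear_intro[of _ C])
       (use bound in \<open>auto simp: add L_scaleR scaleR_conv_of_real mult.commute\<close>)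
  then have "(\<lambda>n. J (v n)) \<longlonglongrightarrow> J u"
    unfolding J_def by (intro tendsto_intros u bounded_linear.tendsto[OF _ u])
  moreover have "(\<lambda>n. m + inverse (real (Suc n))) \<longlonglongrightarrow> m + 0"
    by (intro tendsto_intros LIMSEQ_inverse_real_of_nat)
  ultimately have Ju: "J u \<le> m"
    using LIMSEQ_le[of "\<lambda>n. J (v n)" "J u" "\<lambda>n. m + inverse (real (Suc n))"] v
    by (metis (no_types, lifting) add.right_neutral less_imp_le)
  have real_part: "Re (cinner u g) = Re (L g)" for g
  proof -
    define D where "D = Re (cinner u g) - Re (L g)"
    define N where "N = (norm g)\<^sup>2"
    have N0: "N \<ge> 0" by (simp add: N_def)
    have quad: "0 \<le> 2 * t * D + t\<^sup>2 * N" for t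
    proof -
      have "J (u + t *\<^sub>R g) = J u + 2 * t * D + t\<^sup>2 * N"
        by (simp add: J_def D_def N_def norm_add_sq add L_scaleR cinner_scaleR_right
            power_mult_distrib algebra_simps)
      then show ?thesis using m_le[of "u + t *\<^sub>R g"] Ju by linarith
    qed
    \<comment> \<open>The parabola is smallest at \<open>t = - D / N\<close>; the denominator
      \<open>N + 1\<close> also covers \<open>N = 0\<close> and still forces
      \<open>D = 0\<close>.\<close>
    have "0 \<le> 2 * (- D / (N + 1)) * D + (- D / (N + 1))\<^sup>2 * N" by (rule quad)
    also have "\<dots> = - (D\<^sup>2 * (N + 2) / (N + 1)\<^sup>2)"
      using N0 by (simp add: divide_simps power2_eq_square) (simp add: algebra_simps)
    finally have "D\<^sup>2 * (N + 2) / (N + 1)\<^sup>2 \<le> 0" by simp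
    then have "D\<^sup>2 \<le> 0"
      using N0 by (simp add: divide_le_0_iff mult_le_0_iff)
    then show ?thesis by (simp add: D_def)
  qed
  have "L x = cinner x u" for x
  proof (rule complex_eqI)
    show "Re (L x) = Re (cinner x u)"
      using real_part[of x] by (subst cinner_commute) simp
    \<comment> \<open>Multiplying the argument by \<open>\<i>\<close> turns imaginary parts, up to
      sign, into real parts.\<close>
    show "Im (L x) = Im (cinner x u)"
      using real_part[of "\<i> *\<^sub>C x"] by (subst cinner_commute) (simp add: scale cinner_scaleC_right)
  qed
  then show ?thesis by (rule that)
qed

section \<open>Integrals against a continuous frame\<close>

text \<open>The pointwise bound of \<open>a * b\<close> by \<open>(t * a^2 + b^2 / t) / 2\<close> is
  integrated and then optimised over \<open>t > 0\<close>.\<close>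

lemma integral_cauchy_schwarz:
  fixes u v :: "'a \<Rightarrow> real"
  assumes u [measurable]: "u \<in> borel_measurable M" and v [measurable]: "v \<in> borel_measurable M"
    and u2: "integrable M (\<lambda>x. (u x)\<^sup>2)" and v2: "integrable M (\<lambda>x. (v x)\<^sup>2)"
  shows "integrable M (\<lambda>x. u x * v x)"
    and "(\<integral>x. u x * v x \<partial>M) \<le> sqrt (\<integral>x. (u x)\<^sup>2 \<partial>M) * sqrt (\<integral>x. (v x)\<^sup>2 \<partial>M)"
proof -
  have amgm: "\<bar>a * b\<bar> \<le> (t * a\<^sup>2 + b\<^sup>2 / t) / 2" if "t > 0" for a b t :: real
  proof -
    have "0 \<le> (t * \<bar>a\<bar> - \<bar>b\<bar>)\<^sup>2" by simp
    then have "2 * t * \<bar>a * b\<bar> \<le> t\<^sup>2 * a\<^sup>2 + b\<^sup>2"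
      by (simp add: power2_diff abs_mult power_mult_distrib)
    then show ?thesis using that by (simp add: field_simps power2_eq_square)
  qed
  show int: "integrable M (\<lambda>x. u x * v x)"
    by (rule Bochner_Integration.integrable_bound[of _ "\<lambda>x. ((u x)\<^sup>2 + (v x)\<^sup>2) / 2"])
       (use amgm[of 1] u2 v2 in simp_all)
  define a b c where "a = (\<integral>x. (u x)\<^sup>2 \<partial>M)" and "b = (\<integral>x. (v x)\<^sup>2 \<partial>M)"
    and "c = (\<integral>x. u x * v x \<partial>M)"
  have ab: "a \<ge> 0" "b \<ge> 0" by (simp_all add: a_def b_def)
  have main: "c \<le> (t * a + b / t) / 2" if "t > 0" for t
  proof -
    have "c \<le> (\<integral>x. (t * (u x)\<^sup>2 + (v x)\<^sup>2 / t) / 2 \<partial>M)"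
      unfolding c_def
      by (rule integral_mono) (use int u2 v2 order_trans[OF abs_ge_self amgm[OF that]] in simp_all)
    also have "\<dots> = (t * a + b / t) / 2"
      using u2 v2 by (simp add: a_def b_def)
    finally show ?thesis .
  qed
  have "c \<le> sqrt a * sqrt b"
  proof (cases "a > 0 \<and> b > 0")
    case True
    \<comment> \<open>The bound is smallest at \<open>t = sqrt b / sqrt a\<close>.\<close>
    then have "c \<le> (sqrt b / sqrt a * a + b / (sqrt b / sqrt a)) / 2"
      by (intro main) simp
    also have "sqrt b / sqrt a * a = sqrt b * sqrt a"
      using True real_sqrt_mult_self[of a] by (simp add: field_simps)
    also have "b / (sqrt b / sqrt a) = sqrt b * sqrt a"
      using True real_sqrt_mult_self[of b] by (simp add: field_simps)
    finally show ?thesis by (simp add: mult.commute)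
  next
    case False
    then have zero: "a = 0 \<or> b = 0" using ab by linarith
    \<comment> \<open>With one of the two integrals zero there is no optimal \<open>t\<close>; a
      single \<open>t\<close> chosen in terms of \<open>c\<close> already yields
      \<open>c \<le> c / 2\<close>, impossible for \<open>c > 0\<close>.\<close>
    have "c \<le> 0"
    proof (rule ccontr)
      assume "\<not> c \<le> 0"
      then have c: "c > 0" by simp
      show False
      proof (cases "a = 0")
        case True
        define q where "q = b * c / (b + 1)"
        have "c \<le> q / 2"
          using main[of "(b + 1) / c"] c ab True by (simp add: q_def add_nonneg_pos)
        moreover have "q \<le> c"
          unfolding q_def using ab c by (simp add: divide_le_eq algebra_simps)
        ultimately show False using c by linarith
      next
        case False
        define q where "q = c * a / (a + 1)"
        have "c \<le> q / 2"
          using main[of "c / (a + 1)"] c ab False zero by (simp add: q_def add_nonneg_pos) (simp add: field_simps)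
        moreover have "q \<le> c"
          unfolding q_def using ab c by (simp add: divide_le_eq algebra_simps)
        ultimately show False using c by linarith
      qed
    qed
    then show ?thesis using ab by (meson mult_nonneg_nonneg order_trans real_sqrt_ge_zero)
  qed
  then show "(\<integral>x. u x * v x \<partial>M) \<le> sqrt (\<integral>x. (u x)\<^sup>2 \<partial>M) * sqrt (\<integral>x. (v x)\<^sup>2 \<partial>M)"
    by (simp add: a_def b_def c_def)
qed

section \<open>The frame as an isometry into L^2, and quadratic forms\<close>

context berezin_quantization
begin

lemma space_mu [simp]: "space \<mu> = UNIV"
  using sets_eq_imp_space_eq[OF borel_measure] by simp

lemma borel_measurable_mu: "borel_measurable \<mu> = borel_measurable borel"
  by (rule measurable_cong_sets[OF borel_measure refl])

lemma frame_inner_continuous: "continuous_on UNIV (\<lambda>x. cinner f (k x))"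
  by (intro bounded_bilinear.continuous_on[OF bounded_bilinear_cinner] continuous_on_const continuous_frame)

lemma frame_inner_measurable [measurable]: "(\<lambda>x. cinner f (k x)) \<in> borel_measurable \<mu>"
  unfolding borel_measurable_mu by (rule borel_measurable_continuous_onI[OF frame_inner_continuous])

lemma frame_inner_measurable' [measurable]: "(\<lambda>x. cinner (k x) f) \<in> borel_measurable \<mu>"
  unfolding borel_measurable_mu
  by (intro borel_measurable_continuous_onI bounded_bilinear.continuous_on[OF bounded_bilinear_cinner] 
      continuous_on_const continuous_frame)

lemma cmod_frame_commute: "cmod (cinner (k x) f) = cmod (cinner f (k x))"
  by (subst cinner_commute) simp

lemma cmod_frame_le: "cmod (cinner f (k x)) \<le> norm f"
  using norm_cinner_le[of f "k x"] by (simp add: normalized_frame)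

text \<open>The weak Parseval identity is tested against \<open>f\<close> itself. Thus sending
  \<open>f\<close> to the function \<open>cinner f (k x)\<close> of \<open>x\<close> is an isometry
  into L^2.\<close>

lemma
  shows frame_sq_integrable: "integrable \<mu> (\<lambda>x. (cmod (cinner f (k x)))\<^sup>2)"
    and frame_sq_integral: "(\<integral>x. (cmod (cinner f (k x)))\<^sup>2 \<partial>\<mu>) = (norm f)\<^sup>2"
proof -
  have eq: "cinner (cinner f (k x) *\<^sub>C k x) f = complex_of_real ((cmod (cinner f (k x)))\<^sup>2)" for x
    by (simp add: cinner_scaleC_left cinner_commute[of "k x" f] complex_norm_square del: of_real_power)
  have int: "integrable \<mu> (\<lambda>x. complex_of_real ((cmod (cinner f (k x)))\<^sup>2))"
    and val: "(\<integral>x. complex_of_real ((cmod (cinner f (k x)))\<^sup>2) \<partial>\<mu>) = complex_of_real ((norm f)\<^sup>2)"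
    using parseval_frame[of f] unfolding has_weak_integral_def eq[symmetric] cinner_self[symmetric] by blast+
  show "integrable \<mu> (\<lambda>x. (cmod (cinner f (k x)))\<^sup>2)"
    using integrable_bounded_linear[OF bounded_linear_Re int] by simp
  then show "(\<integral>x. (cmod (cinner f (k x)))\<^sup>2 \<partial>\<mu>) = (norm f)\<^sup>2"
    using val by (simp only: integral_complex_of_real of_real_eq_iff)
qed

lemma frame_separates: "f = 0" if "\<And>x. cinner f (k x) = 0"
  using frame_sq_integral[of f] that by simp

lemma frame_eqI: "f = g" if "\<And>x. cinner f (k x) = cinner g (k x)"
  using frame_separates[of "f - g"] that by (simp add: cinner_diff_left)

text \<open>Values between 0 and 1 cover \<open>\<sigma>\<close>, \<open>1 - \<sigma>\<close> and
  all indicators at once, persist under complements and products, and keep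
  \<open>form \<rho> f\<close> between 0 and the squared norm of \<open>f\<close>.\<close>

definition symbol :: "('x \<Rightarrow> real) \<Rightarrow> bool" where
  "symbol \<rho> \<longleftrightarrow> \<rho> \<in> borel_measurable \<mu> \<and> (\<forall>x. 0 \<le> \<rho> x \<and> \<rho> x \<le> 1)"

lemma symbol_measurable: "symbol \<rho> \<Longrightarrow> \<rho> \<in> borel_measurable \<mu>"
  and symbol_nonneg: "symbol \<rho> \<Longrightarrow> 0 \<le> \<rho> x"
  and symbol_le_1: "symbol \<rho> \<Longrightarrow> \<rho> x \<le> 1"
  by (auto simp: symbol_def)

lemma symbol_indicator: "S \<in> sets borel \<Longrightarrow> symbol (indicator S)"
  by (auto simp: symbol_def borel_measurable_mu indicator_def)

lemma symbol_complement: "symbol \<rho> \<Longrightarrow> symbol (\<lambda>x. 1 - \<rho> x)"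
  by (auto simp: symbol_def)

lemma symbol_mult: "symbol \<rho> \<Longrightarrow> symbol \<rho>' \<Longrightarrow> symbol (\<lambda>x. \<rho> x * \<rho>' x)"
  by (auto simp: symbol_def mult_le_one)

definition form :: "('x \<Rightarrow> real) \<Rightarrow> 'h \<Rightarrow> real" where
  "form \<rho> f = (\<integral>x. \<rho> x * (cmod (cinner f (k x)))\<^sup>2 \<partial>\<mu>)"

lemma berezin_transform_eq_form: "berezin_transform \<mu> k \<rho> y = form \<rho> (k y)"
  unfolding berezin_transform_def form_def cmod_frame_commute[of _ "k y"] ..

lemma form_integrable: "symbol \<rho> \<Longrightarrow> integrable \<mu> (\<lambda>x. \<rho> x * (cmod (cinner f (k x)))\<^sup>2)"
proof (rule Bochner_Integration.integrable_bound[OF frame_sq_integrable[of f]])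
  assume \<rho>: "symbol \<rho>"
  note [measurable] = symbol_measurable[OF \<rho>]
  show "(\<lambda>x. \<rho> x * (cmod (cinner f (k x)))\<^sup>2) \<in> borel_measurable \<mu>" by measurable
  show "AE x in \<mu>. norm (\<rho> x * (cmod (cinner f (k x)))\<^sup>2) \<le> norm ((cmod (cinner f (k x)))\<^sup>2)"
    by (rule AE_I2) (simp add: abs_mult symbol_nonneg[OF \<rho>] symbol_le_1[OF \<rho>] mult_left_le_one_le)
qed

lemma form_nonneg: "symbol \<rho> \<Longrightarrow> 0 \<le> form \<rho> f"
  unfolding form_def by (rule Bochner_Integration.integral_nonneg) (simp add: symbol_nonneg)

lemma form_mono:
  assumes "symbol \<rho>" "symbol \<rho>'" "\<And>x. cinner f (k x) \<noteq> 0 \<Longrightarrow> \<rho> x \<le> \<rho>' x"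
  shows "form \<rho> f \<le> form \<rho>' f"
  unfolding form_def
proof (rule integral_mono[OF form_integrable form_integrable, OF assms(1,2)])
  fix x
  show "\<rho> x * (cmod (cinner f (k x)))\<^sup>2 \<le> \<rho>' x * (cmod (cinner f (k x)))\<^sup>2"
    using assms(3)[of x] by (cases "cinner f (k x) = 0") (simp_all add: mult_right_mono)
qed

lemma form_complement: 
  assumes "symbol \<rho>"
  shows "form \<rho> f + form (\<lambda>x. 1 - \<rho> x) f = (norm f)\<^sup>2"
proof -
  have "form \<rho> f + form (\<lambda>x. 1 - \<rho> x) f 
    = (\<integral>x. \<rho> x * (cmod (cinner f (k x)))\<^sup>2 + (1 - \<rho> x) * (cmod (cinner f (k x)))\<^sup>2 \<partial>\<mu>)"
    unfolding form_def 
    by (rule Bochner_Integration.integral_add[symmetric]; rule form_integrable) 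
       (fact assms symbol_complement[OF assms])+
  also have "\<dots> = (\<integral>x. (cmod (cinner f (k x)))\<^sup>2 \<partial>\<mu>)"
    by (rule Bochner_Integration.integral_cong) (simp_all add: left_diff_distrib)
  finally show ?thesis by (simp add: frame_sq_integral)
qed

lemma form_le_norm: "symbol \<rho> \<Longrightarrow> form \<rho> f \<le> (norm f)\<^sup>2"
  using form_complement[of \<rho> f] form_nonneg[OF symbol_complement, of \<rho> f] by simp

lemma form_add_le:
  assumes "symbol \<rho>" "symbol \<rho>1" "symbol \<rho>2" "\<And>x. \<rho> x \<le> \<rho>1 x + \<rho>2 x"
  shows "form \<rho> f \<le> form \<rho>1 f + form \<rho>2 f"
proof -
  have "form \<rho> f \<le> (\<integral>x. \<rho>1 x * (cmod (cinner f (k x)))\<^sup>2 + \<rho>2 x * (cmod (cinner f (k x)))\<^sup>2 \<partial>\<mu>)"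
    unfolding form_def
  proof (rule integral_mono[OF form_integrable[OF assms(1)]])
    show "integrable \<mu> (\<lambda>x. \<rho>1 x * (cmod (cinner f (k x)))\<^sup>2 + \<rho>2 x * (cmod (cinner f (k x)))\<^sup>2)"
      by (intro Bochner_Integration.integrable_add form_integrable assms)
    show "\<rho> x * (cmod (cinner f (k x)))\<^sup>2 
        \<le> \<rho>1 x * (cmod (cinner f (k x)))\<^sup>2 + \<rho>2 x * (cmod (cinner f (k x)))\<^sup>2" for x
      unfolding distrib_right[symmetric] by (rule mult_right_mono[OF assms(4)]) simp
  qed
  also have "\<dots> = form \<rho>1 f + form \<rho>2 f"
    unfolding form_def by (rule Bochner_Integration.integral_add; rule form_integrable; fact assms)
  finally show ?thesis .
qed

text \<open>A substitute for the triangle inequality, from the pointwise bound of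
  \<open>|a - b|^2\<close> by \<open>2 |a|^2 + 2 |b|^2\<close>. The factor 2 is harmless where forms
  only have to tend to zero.\<close>

lemma form_diff_le: "symbol \<rho> \<Longrightarrow> form \<rho> (f - g) \<le> 2 * form \<rho> f + 2 * form \<rho> g"
proof -
  assume \<rho>: "symbol \<rho>"
  have "form \<rho> (f - g) \<le> (\<integral>x. 2 * (\<rho> x * (cmod (cinner f (k x)))\<^sup>2) + 2 * (\<rho> x * (cmod (cinner g (k x)))\<^sup>2) \<partial>\<mu>)"
    unfolding form_def
  proof (rule integral_mono)
    fix x
    have "cmod (cinner (f - g) (k x)) \<le> cmod (cinner f (k x)) + cmod (cinner g (k x))"
      by (simp add: cinner_diff_left norm_triangle_ineq4)
    then have "(cmod (cinner (f - g) (k x)))\<^sup>2 \<le> (cmod (cinner f (k x)) + cmod (cinner g (k x)))\<^sup>2"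
      by (simp add: power_mono)
    also have "\<dots> \<le> 2 * (cmod (cinner f (k x)))\<^sup>2 + 2 * (cmod (cinner g (k x)))\<^sup>2"
      using zero_le_power2[of "cmod (cinner f (k x)) - cmod (cinner g (k x))"]
      by (simp add: power2_sum power2_diff)
    finally have "\<rho> x * (cmod (cinner (f - g) (k x)))\<^sup>2
      \<le> \<rho> x * (2 * (cmod (cinner f (k x)))\<^sup>2 + 2 * (cmod (cinner g (k x)))\<^sup>2)"
      using symbol_nonneg[OF \<rho>] by (rule mult_left_mono)
    then show "\<rho> x * (cmod (cinner (f - g) (k x)))\<^sup>2 
      \<le> 2 * (\<rho> x * (cmod (cinner f (k x)))\<^sup>2) + 2 * (\<rho> x * (cmod (cinner g (k x)))\<^sup>2)"
      by (simp add: algebra_simps)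
  qed (auto intro!: form_integrable \<rho>)
  also have "\<dots> = 2 * form \<rho> f + 2 * form \<rho> g"
    unfolding form_def using form_integrable[OF \<rho>, of f] form_integrable[OF \<rho>, of g] by simp
  finally show ?thesis .
qed

text \<open>Cauchy-Schwarz with the whole of \<open>\<rho>\<close> put on the side of
  \<open>g\<close>, where its square is at most \<open>\<rho>\<close>. The asymmetry is deliberate:
  with \<open>g = k y\<close> the right-hand side contains the Berezin transform at
  \<open>y\<close>.\<close>

lemma
  assumes \<rho>: "symbol \<rho>"
  shows frame_product_integrable:
      "integrable \<mu> (\<lambda>x. complex_of_real (\<rho> x) * cinner f (k x) * cinner (k x) g)"
    and frame_product_le:
      "cmod (\<integral>x. complex_of_real (\<rho> x) * cinner f (k x) * cinner (k x) g \<partial>\<mu>) 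
        \<le> norm f * sqrt (form \<rho> g)"
proof -
  note [measurable] = symbol_measurable[OF \<rho>]
  define u v where "u x = cmod (cinner f (k x))" and "v x = \<rho> x * cmod (cinner g (k x))" for x
  have [measurable]: "u \<in> borel_measurable \<mu>" "v \<in> borel_measurable \<mu>"
    unfolding u_def v_def by measurable
  have "(\<rho> x)\<^sup>2 \<le> \<rho> x" for x
    using symbol_nonneg[OF \<rho>, of x] symbol_le_1[OF \<rho>, of x] by (simp add: power2_eq_square mult_left_le)
  then have v2le: "(v x)\<^sup>2 \<le> \<rho> x * (cmod (cinner g (k x)))\<^sup>2" for x
    by (simp add: v_def power_mult_distrib mult_right_mono)
  have u2: "integrable \<mu> (\<lambda>x. (u x)\<^sup>2)" unfolding u_def by (rule frame_sq_integrable)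
  have v2: "integrable \<mu> (\<lambda>x. (v x)\<^sup>2)"
    by (rule Bochner_Integration.integrable_bound[OF form_integrable[OF \<rho>, of g]])
       (use v2le in \<open>auto intro: order_trans[OF _ abs_ge_self]\<close>)
  have int: "integrable \<mu> (\<lambda>x. u x * v x)" 
    by (rule integral_cauchy_schwarz(1)[OF _ _ u2 v2]) measurable
  have bd: "cmod (complex_of_real (\<rho> x) * cinner f (k x) * cinner (k x) g) = u x * v x" for x
    by (simp add: u_def v_def norm_mult cmod_frame_commute symbol_nonneg[OF \<rho>])
  show i: "integrable \<mu> (\<lambda>x. complex_of_real (\<rho> x) * cinner f (k x) * cinner (k x) g)"
    by (rule Bochner_Integration.integrable_bound[OF int]) (auto simp: bd)
  have "cmod (\<integral>x. complex_of_real (\<rho> x) * cinner f (k x) * cinner (k x) g \<partial>\<mu>) \<le> (\<integral>x. u x * v x \<partial>\<mu>)"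
    using integral_norm_bound[of \<mu> "\<lambda>x. complex_of_real (\<rho> x) * cinner f (k x) * cinner (k x) g"]
    by (simp add: bd)
  also have "\<dots> \<le> sqrt (\<integral>x. (u x)\<^sup>2 \<partial>\<mu>) * sqrt (\<integral>x. (v x)\<^sup>2 \<partial>\<mu>)"
    by (rule integral_cauchy_schwarz(2)[OF _ _ u2 v2]) measurable
  also have "sqrt (\<integral>x. (u x)\<^sup>2 \<partial>\<mu>) = norm f"
    by (simp add: u_def frame_sq_integral)
  also have "(\<integral>x. (v x)\<^sup>2 \<partial>\<mu>) \<le> form \<rho> g"
    unfolding form_def by (rule integral_mono[OF v2 form_integrable[OF \<rho>] v2le])
  finally show "cmod (\<integral>x. complex_of_real (\<rho> x) * cinner f (k x) * cinner (k x) g \<partial>\<mu>) 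
      \<le> norm f * sqrt (form \<rho> g)"
    by (simp add: mult_left_mono)
qed

text \<open>The operator is defined by a definite description, so existence and uniqueness of the
  weak integral are both due. Existence is Riesz representation, applied to the conjugated
  functional because \<open>g\<close> stands in the antilinear slot; uniqueness holds because the
  frame separates vectors.\<close>

lemma toeplitz_weak_integral:
  assumes \<rho>: "symbol \<rho>"
  shows "has_weak_integral \<mu> (\<lambda>x. (complex_of_real (\<rho> x) * cinner f (k x)) *\<^sub>C k x) (toeplitz \<mu> k \<rho> f)"
proof -
  define I where "I g = (\<integral>x. complex_of_real (\<rho> x) * cinner f (k x) * cinner (k x) g \<partial>\<mu>)" for g
  have add: "cnj (I (x + y)) = cnj (I x) + cnj (I y)" for x y
    unfolding I_def
    by (simp add: cinner_add_right distrib_left frame_product_integrable[OF \<rho>])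
  have scale: "cnj (I (a *\<^sub>C x)) = a * cnj (I x)" for a x
  proof -
    have "I (a *\<^sub>C x) = (\<integral>y. cnj a * (complex_of_real (\<rho> y) * cinner f (k y) * cinner (k y) x) \<partial>\<mu>)"
      unfolding I_def by (simp add: cinner_scaleC_right mult_ac)
    then show ?thesis by (simp add: I_def)
  qed
  have bound: "cmod (cnj (I x)) \<le> norm f * norm x" for x
  proof -
    have "cmod (I x) \<le> norm f * sqrt (form \<rho> x)"
      unfolding I_def by (rule frame_product_le[OF \<rho>])
    also have "sqrt (form \<rho> x) \<le> norm x"
      using form_le_norm[OF \<rho>, of x] by (simp add: real_le_lsqrt)
    finally show ?thesis by (simp add: mult_left_mono)
  qed
  obtain v where v: "\<And>x. cnj (I x) = cinner x v"
    using riesz_representation[of "\<lambda>x. cnj (I x)", OF add scale bound] by blast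
  have "I g = cinner v g" for g
    using v[of g] by (subst cinner_commute) (metis complex_cnj_cnj)
  then have ex: "has_weak_integral \<mu> (\<lambda>x. (complex_of_real (\<rho> x) * cinner f (k x)) *\<^sub>C k x) v"
    unfolding has_weak_integral_def I_def
    by (simp add: cinner_scaleC_left frame_product_integrable[OF \<rho>])
  have uniq: "v' = v" 
    if "has_weak_integral \<mu> (\<lambda>x. (complex_of_real (\<rho> x) * cinner f (k x)) *\<^sub>C k x) v'" for v'
    by (rule frame_eqI) (use ex that in \<open>metis has_weak_integral_def\<close>)
  show ?thesis
    unfolding toeplitz_def weak_integral_def by (rule theI[of _ v]) (fact ex uniq)+
qed

lemma cinner_toeplitz:
  "symbol \<rho> \<Longrightarrow> cinner (toeplitz \<mu> k \<rho> f) g = (\<integral>x. complex_of_real (\<rho> x) * cinner f (k x) * cinner (k x) g \<partial>\<mu>)"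
  using toeplitz_weak_integral[of \<rho> f] unfolding has_weak_integral_def by (simp add: cinner_scaleC_left)

lemma cinner_toeplitz_self: 
  assumes "symbol \<rho>"
  shows "cinner (toeplitz \<mu> k \<rho> f) f = complex_of_real (form \<rho> f)"
proof -
  have "complex_of_real (\<rho> x) * cinner f (k x) * cinner (k x) f 
      = complex_of_real (\<rho> x * (cmod (cinner f (k x)))\<^sup>2)" for x
    by (simp add: cinner_commute[of "k x" f] complex_norm_square mult.assoc del: of_real_power)
  then show ?thesis
    unfolding cinner_toeplitz[OF assms] form_def by (simp only: integral_complex_of_real)
qed

end

section \<open>Invariance and local finiteness\<close>

context berezin_quantization
begin

section \<open>The action by measure-preserving isometries, and local finiteness\<close>

lemma action_one: "\<phi> \<one> x = x"
  using id_eq_one by (metis UNIV_I restrict_apply')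

lemma action_mult: "g \<in> carrier G \<Longrightarrow> h \<in> carrier G \<Longrightarrow> \<phi> (g \<otimes> h) x = \<phi> g (\<phi> h x)"
  by (rule composition_rule) simp_all

lemma action_inv: "g \<in> carrier G \<Longrightarrow> \<phi> (inv g) (\<phi> g x) = x"
  using action_mult[of "inv g" g x] by (simp add: action_one)

lemma action_inv': "g \<in> carrier G \<Longrightarrow> \<phi> g (\<phi> (inv g) x) = x"
  using action_mult[of g "inv g" x] by (simp add: action_one)

lemma action_image: "g \<in> carrier G \<Longrightarrow> \<phi> g ` S = \<phi> (inv g) -` S"
proof safe
  fix x assume "g \<in> carrier G" "\<phi> (inv g) x \<in> S"
  then show "x \<in> \<phi> g ` S" using action_inv'[of g x] by (metis imageI)
qed (simp add: action_inv)

lemma action_vimage: "g \<in> carrier G \<Longrightarrow> \<phi> g -` S = \<phi> (inv g) ` S"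
  by (simp add: action_image)

lemma action_ball: "g \<in> carrier G \<Longrightarrow> \<phi> g ` ball y r = ball (\<phi> g y) r"
  unfolding action_image using dist_invariant[of g y] action_inv'[of g] by (auto simp: vimage_def) metis+

lemma action_isometry_continuous: "g \<in> carrier G \<Longrightarrow> continuous_on S (\<phi> g)"
  unfolding continuous_on_iff using dist_invariant[of g] by metis

lemma action_measurable: "g \<in> carrier G \<Longrightarrow> \<phi> g \<in> measurable \<mu> \<mu>"
  using borel_measurable_continuous_onI[OF action_isometry_continuous, of g]
  by (simp add: measurable_cong_sets[OF borel_measure borel_measure])

lemma distr_action: "g \<in> carrier G \<Longrightarrow> distr \<mu> \<mu> (\<phi> g) = \<mu>"
proof (rule measure_eqI)
  fix A assume g: "g \<in> carrier G" and "A \<in> sets (distr \<mu> \<mu> (\<phi> g))"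
  then have A: "A \<in> sets \<mu>" by simp
  show "emeasure (distr \<mu> \<mu> (\<phi> g)) A = emeasure \<mu> A"
    using emeasure_distr[OF action_measurable[OF g] A] measure_invariant[of "inv g" A] g A
    by (simp add: action_vimage)
qed simp

lemma integral_action:
  fixes f :: "'x \<Rightarrow> real"
  assumes "g \<in> carrier G" "f \<in> borel_measurable \<mu>"
  shows "(\<integral>x. f (\<phi> g x) \<partial>\<mu>) = (\<integral>x. f x \<partial>\<mu>)"
  using integral_distr[OF action_measurable[OF assms(1)] assms(2)] by (simp add: distr_action assms(1))

lemma transitive: "\<exists>g\<in>carrier G. \<phi> g x = y"
  by (rule unique_orbit) simp_all

text \<open>By properness each ball of integer radius has a finite net at every scale. A countable
  dense set is needed both for measurability on the product space and for the diagonal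
  argument.\<close>

lemma separable: "\<exists>D::'x set. countable D \<and> closure D = UNIV"
proof -
  fix z :: 'x
  have "\<exists>F. finite F \<and> closure (ball z (real n)) \<subseteq> (\<Union>x\<in>F. ball x (inverse (real (Suc m))))" for n m
  proof (rule compactE_image[OF proper_metric])
    have "x \<in> ball x (inverse (real (Suc m)))" for x :: 'x by simp
    then show "closure (ball z (real n)) \<subseteq> (\<Union>x\<in>UNIV. ball x (inverse (real (Suc m))))" by blast
  qed blast+
  then obtain F where F: "\<And>n m. finite (F n m)"
    "\<And>n m. closure (ball z (real n)) \<subseteq> (\<Union>x\<in>F n m. ball x (inverse (real (Suc m))))"
    by metis
  define D where "D = (\<Union>n m. F n m)"
  have "countable D" unfolding D_def by (intro countable_UN countableI_type countable_finite F(1))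
  moreover have "x \<in> closure D" for x
    unfolding closure_approachable
  proof (intro allI impI)
    fix e :: real assume "e > 0"
    then obtain m where m: "inverse (real (Suc m)) < e" using reals_Archimedean by blast
    obtain n where "dist z x < real n" using reals_Archimedean2 by blast
    then have "x \<in> closure (ball z (real n))" by (intro subsetD[OF closure_subset]) simp
    then obtain y where "y \<in> F n m" "x \<in> ball y (inverse (real (Suc m)))" using F(2)[of n m] by blast
    then show "\<exists>y\<in>D. dist y x < e" using m unfolding D_def by force
  qed
  ultimately show ?thesis by blast
qed

text \<open>Finiteness comes from the frame. Near \<open>y\<close> the function
  \<open>cmod (cinner (k y) (k x))\<close> exceeds 1/2, and its square is integrable, so 4 times
  that square dominates the indicator of a small ball. Compactness passes to arbitrary
  balls.\<close>

lemma ball_finite: "emeasure \<mu> (ball y r) < \<infinity>"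
proof -
  have local: "\<exists>d>0. emeasure \<mu> (ball y d) < \<infinity>" for y
  proof -
    have "isCont (\<lambda>x. cmod (cinner (k y) (k x))) y"
      using frame_inner_continuous[of "k y"] 
      by (intro continuous_norm) (simp add: continuous_on_eq_continuous_at)
    then have "((\<lambda>x. cmod (cinner (k y) (k x))) \<longlongrightarrow> cmod (cinner (k y) (k y))) (nhds y)"
      by (metis isCont_def tendsto_nhds_iff)
    then have "\<forall>\<^sub>F x in nhds y. cmod (cinner (k y) (k x)) > 1/2"
      by (intro order_tendstoD(1)[of _ "cmod (cinner (k y) (k y))"])
         (simp_all add: cinner_self normalized_frame)
    then obtain d where d: "d > 0" "\<And>x. dist x y < d \<Longrightarrow> cmod (cinner (k y) (k x)) > 1/2"
      unfolding eventually_nhds_metric by blast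
    have "emeasure \<mu> (ball y d) = (\<integral>\<^sup>+x. indicator (ball y d) x \<partial>\<mu>)"
      by (simp add: borel_measure)
    also have "\<dots> \<le> (\<integral>\<^sup>+x. ennreal (4 * (cmod (cinner (k y) (k x)))\<^sup>2) \<partial>\<mu>)"
    proof (rule nn_integral_mono)
      fix x
      have "ennreal 1 \<le> ennreal (4 * (cmod (cinner (k y) (k x)))\<^sup>2)" if "dist y x < d"
      proof (rule ennreal_leI)
        have "(1/2)\<^sup>2 \<le> (cmod (cinner (k y) (k x)))\<^sup>2"
          using d(2)[of x] that by (intro power_mono) (auto simp: dist_commute)
        then show "1 \<le> 4 * (cmod (cinner (k y) (k x)))\<^sup>2" by (simp add: power2_eq_square)
      qed
      then show "indicator (ball y d) x \<le> ennreal (4 * (cmod (cinner (k y) (k x)))\<^sup>2)"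
        by (auto simp: indicator_def)
    qed
    also have "\<dots> < \<infinity>"
      using frame_sq_integrable[of "k y"] by (subst nn_integral_eq_integral) auto
    finally show ?thesis using d(1) by blast
  qed
  then obtain d where d: "\<And>y. d y > 0" "\<And>y. emeasure \<mu> (ball y (d y)) < \<infinity>" by metis
  obtain F where F: "finite F" "closure (ball y r) \<subseteq> (\<Union>x\<in>F. ball x (d x))"
  proof (rule compactE_image[OF proper_metric])
    have "x \<in> ball x (d x)" for x using d(1) by simp
    then show "closure (ball y r) \<subseteq> (\<Union>x\<in>UNIV. ball x (d x))" by blast
  qed (use that in auto)
  have "ball y r \<subseteq> (\<Union>x\<in>F. ball x (d x))" using F(2) closure_subset by blast
  then have "emeasure \<mu> (ball y r) \<le> emeasure \<mu> (\<Union>x\<in>F. ball x (d x))"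
    by (rule emeasure_mono) (use borel_open[OF open_UN[of F "\<lambda>x. ball x (d x)"]] in \<open>simp add: borel_measure\<close>)
  also have "\<dots> \<le> (\<Sum>x\<in>F. emeasure \<mu> (ball x (d x)))"
    by (rule emeasure_subadditive_finite) (auto simp: F borel_measure)
  also have "\<dots> < \<infinity>" using d(2) by (simp add: F)
  finally show ?thesis .
qed

lemma sigma_finite: "sigma_finite_measure \<mu>"
proof
  fix z :: 'x
  have "(\<Union>n. ball z (real n)) = UNIV"
    using reals_Archimedean2 by auto
  then show "\<exists>A. countable A \<and> A \<subseteq> sets \<mu> \<and> \<Union> A = space \<mu> \<and> (\<forall>a\<in>A. emeasure \<mu> a \<noteq> \<infinity>)"
    using ball_finite by (intro exI[of _ "range (\<lambda>n. ball z (real n))"]) (auto simp: borel_measure less_top)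
qed

lemma measure_ball_eq: "measure \<mu> (ball x r) = measure \<mu> (ball y r)"
proof -
  obtain g where "g \<in> carrier G" "\<phi> g x = y" using transitive by blast
  then show ?thesis
    using measure_invariant[of g "ball x r"] by (simp add: action_ball borel_measure measure_def)
qed

section \<open>Invariance of the forms and uniform tails\<close>

lemma form_translate:
  assumes "g \<in> carrier G" "symbol \<rho>"
  shows "form (\<lambda>x. \<rho> (\<phi> g x)) (k y) = form \<rho> (k (\<phi> g y))"
proof -
  note [measurable] = symbol_measurable[OF assms(2)]
  have "(\<integral>x. \<rho> (\<phi> g x) * (cmod (cinner (k (\<phi> g y)) (k (\<phi> g x))))\<^sup>2 \<partial>\<mu>)
      = (\<integral>x. \<rho> x * (cmod (cinner (k (\<phi> g y)) (k x)))\<^sup>2 \<partial>\<mu>)"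
    by (rule integral_action[OF assms(1)]) measurable
  then show ?thesis
    unfolding form_def by (simp add: frame_invariant[OF assms(1)])
qed

lemma symbol_compl_ball: "symbol (indicator (- ball y r))"
  by (rule symbol_indicator) simp

lemma form_compl_ball_eq: 
  "form (indicator (- ball x r)) (k x) = form (indicator (- ball y r)) (k y)"
proof -
  obtain g where g: "g \<in> carrier G" "\<phi> g x = y" using transitive by blast
  then have "indicator (- ball y r) (\<phi> g u) = (indicator (- ball x r) u :: real)" for u
    using dist_invariant[of g x u] by (simp add: indicator_def)
  then show ?thesis
    using form_translate[OF g(1) symbol_compl_ball[of y r], of x] g(2) by simp
qed

lemma form_compl_ball_tendsto: "(\<lambda>n. form (indicator (- ball z (real n))) f) \<longlonglongrightarrow> 0"
proof -
  have "(\<lambda>n. \<integral>x. indicator (- ball z (real n)) x * (cmod (cinner f (k x)))\<^sup>2 \<partial>\<mu>) \<longlonglongrightarrow> (\<integral>x. 0 \<partial>\<mu>)"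
  proof (rule integral_dominated_convergence[OF _ _ frame_sq_integrable[of f]])
    show "AE x in \<mu>. (\<lambda>n. indicator (- ball z (real n)) x * (cmod (cinner f (k x)))\<^sup>2) \<longlonglongrightarrow> 0"
    proof (rule AE_I2)
      fix x
      obtain N where N: "dist z x < real N" using reals_Archimedean2 by blast
      have "\<forall>\<^sub>F n in sequentially. indicator (- ball z (real n)) x * (cmod (cinner f (k x)))\<^sup>2 = 0"
        using eventually_ge_at_top[of N] by eventually_elim (use N in \<open>auto simp: indicator_def\<close>)
      then show "(\<lambda>n. indicator (- ball z (real n)) x * (cmod (cinner f (k x)))\<^sup>2) \<longlonglongrightarrow> 0"
        by (rule tendsto_eventually)
    qed
    show "(\<lambda>x. indicator (- ball z (real n)) x * (cmod (cinner f (k x)))\<^sup>2) \<in> borel_measurable \<mu>" for n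
      using form_integrable[OF symbol_compl_ball] by (rule borel_measurable_integrable)
    show "AE x in \<mu>. norm (indicator (- ball z (real n)) x * (cmod (cinner f (k x)))\<^sup>2) \<le> (cmod (cinner f (k x)))\<^sup>2" for n
      by (rule AE_I2) (simp add: indicator_def)
  qed simp
  then show ?thesis by (simp add: form_def)
qed

text \<open>Transitivity makes the tail of \<open>k y\<close> outside a ball about \<open>y\<close>
  independent of \<open>y\<close>, so the decay at a single point is already uniform.\<close>

lemma uniform_tail:
  assumes "e > 0"
  obtains r where "r > 0" "\<And>y. form (indicator (- ball y r)) (k y) < e"
proof -
  fix z :: 'x
  have "\<forall>\<^sub>F n in sequentially. n > 0 \<and> form (indicator (- ball z (real n))) (k z) < e"
    using order_tendstoD(2)[OF form_compl_ball_tendsto assms] eventually_gt_at_top[of 0] 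
    by eventually_elim auto
  then obtain n where "n > 0" "form (indicator (- ball z (real n))) (k z) < e"
    using eventually_happens'[OF sequentially_bot] by blast
  then show ?thesis
    using that[of "real n"] form_compl_ball_eq[of _ "real n" z] by (metis of_nat_0_less_iff)
qed

text \<open>The product sigma-algebra is generated by rectangles, so an open set has to be written
  as a countable union of them; the dense set supplies the centres.\<close>

lemma open_pair_measurable:
  fixes U :: "('x \<times> 'x) set"
  assumes "open U"
  shows "U \<in> sets (\<mu> \<Otimes>\<^sub>M \<mu>)"
proof -
  obtain D :: "'x set" where D: "countable D" "closure D = UNIV" using separable by blast
  define r where "r n = inverse (real (Suc n))" for n
  define I where "I = {(a, b, n). a \<in> D \<and> b \<in> D \<and> ball a (r n) \<times> ball b (r n) \<subseteq> U}"
  have "I \<subseteq> D \<times> D \<times> UNIV" by (auto simp: I_def)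
  then have cI: "countable I"
    by (rule countable_subset) (intro countable_SIGMA D(1) countableI_type)
  have "U = (\<Union>(a, b, n)\<in>I. ball a (r n) \<times> ball b (r n))"
  proof (intro equalityI subsetI)
    fix p assume "p \<in> U"
    obtain x y where p: "p = (x, y)" by (cases p)
    obtain A B where AB: "open A" "open B" "x \<in> A" "y \<in> B" "A \<times> B \<subseteq> U"
      using open_prod_elim[OF assms \<open>p \<in> U\<close>] unfolding p by (metis mem_Sigma_iff)
    obtain e1 where e1: "e1 > 0" "ball x e1 \<subseteq> A" using AB openE by blast
    obtain e2 where e2: "e2 > 0" "ball y e2 \<subseteq> B" using AB openE by blast
    \<comment> \<open>Half the radius, because a ball of radius \<open>r n\<close> that contains
      \<open>x\<close> reaches up to distance \<open>2 * r n\<close> from \<open>x\<close>.\<close>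
    obtain n where n: "r n < min e1 e2 / 2"
      using reals_Archimedean[of "min e1 e2 / 2"] e1 e2 unfolding r_def by auto
    have rn: "r n > 0" by (simp add: r_def)
    obtain a where a: "a \<in> D" "dist a x < r n"
      using D(2) rn closure_approachable by (metis UNIV_I)
    obtain b where b: "b \<in> D" "dist b y < r n"
      using D(2) rn closure_approachable by (metis UNIV_I)
    have "ball a (r n) \<subseteq> ball x e1"
      using a n by (auto simp: subset_iff) (smt (verit) dist_commute dist_triangle2 field_sum_of_halves min_def)
    moreover have "ball b (r n) \<subseteq> ball y e2"
      using b n by (auto simp: subset_iff) (smt (verit) dist_commute dist_triangle2 field_sum_of_halves min_def)
    ultimately have "(a, b, n) \<in> I"
      unfolding I_def using a b AB e1 e2 by blast
    moreover have "p \<in> ball a (r n) \<times> ball b (r n)" using a b p by simp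
    ultimately show "p \<in> (\<Union>(a, b, n)\<in>I. ball a (r n) \<times> ball b (r n))" by blast
  qed (auto simp: I_def)
  moreover have "ball a (r n) \<times> ball b (r n) \<in> sets (\<mu> \<Otimes>\<^sub>M \<mu>)" for a b n
    by (rule pair_measureI) (simp_all add: borel_measure)
  ultimately show ?thesis
    using cI by (metis (no_types, lifting) sets.countable_UN' case_prod_beta image_subsetI)
qed

lemma continuous_pair_measurable:
  fixes F :: "'x \<times> 'x \<Rightarrow> real"
  assumes "continuous_on UNIV F"
  shows "F \<in> borel_measurable (\<mu> \<Otimes>\<^sub>M \<mu>)"
proof (rule borel_measurableI)
  fix S :: "real set" assume "open S"
  then have "open (F -` S)" using assms by (simp add: continuous_on_open_vimage)
  then show "F -` S \<inter> space (\<mu> \<Otimes>\<^sub>M \<mu>) \<in> sets (\<mu> \<Otimes>\<^sub>M \<mu>)"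
    by (simp add: open_pair_measurable space_pair_measure)
qed

end

section \<open>Schur's test and compactness\<close>

text \<open>The weight enters through the bound of \<open>2 F(x) F(y)\<close> by
  \<open>F(x)^2 v(y) / v(x) + F(y)^2 v(x) / v(y)\<close>. By symmetry of the kernel and Tonelli's
  theorem both halves have the same integral. Working with extended nonnegative integrals means that
  no integrability has to be known beforehand.\<close>

lemma (in sigma_finite_measure) schur_test:
  fixes a :: "'a \<Rightarrow> 'a \<Rightarrow> ennreal" and F v :: "'a \<Rightarrow> real"
  assumes a [measurable]: "case_prod a \<in> borel_measurable (M \<Otimes>\<^sub>M M)"
    and F [measurable]: "F \<in> borel_measurable M" and v [measurable]: "v \<in> borel_measurable M"
    and pos: "\<And>x. v x > 0"
    and sym: "\<And>x y. a x y = a y x"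
    and bound: "\<And>x. ennreal (inverse (v x)) * (\<integral>\<^sup>+y. a x y * ennreal (v y) \<partial>M) \<le> C"
  shows "(\<integral>\<^sup>+x. \<integral>\<^sup>+y. a x y * ennreal (F x * F y) \<partial>M \<partial>M) \<le> C * (\<integral>\<^sup>+x. ennreal ((F x)\<^sup>2) \<partial>M)"
proof -
  note inner_measurable = borel_measurable_nn_integral
  interpret pair_sigma_finite M M ..
  define b where "b x y = a x y * ennreal ((F x)\<^sup>2 / 2 * inverse (v x) * v y)" for x y
  have b [measurable]: "case_prod b \<in> borel_measurable (M \<Otimes>\<^sub>M M)"
    unfolding b_def by measurable
  have b': "case_prod (\<lambda>x y. b y x) \<in> borel_measurable (M \<Otimes>\<^sub>M M)"
    using measurable_pair_swap[OF b] by (simp add: case_prod_beta)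
  have am: "(\<lambda>y. a x y) \<in> borel_measurable M" if "x \<in> space M" for x
    using measurable_compose[OF measurable_Pair1'[OF that] a] by simp
  have bm: "(\<lambda>y. b x y) \<in> borel_measurable M" if "x \<in> space M" for x
    using measurable_compose[OF measurable_Pair1'[OF that] b] by simp
  have bm': "(\<lambda>y. b y x) \<in> borel_measurable M" if "x \<in> space M" for x
    using measurable_compose[OF measurable_Pair1'[OF that] b'] by simp
  have half: "ennreal ((F x)\<^sup>2 / 2) + ennreal ((F x)\<^sup>2 / 2) = ennreal ((F x)\<^sup>2)" for x
    by (subst ennreal_plus[symmetric]) simp_all
  have le: "a x y * ennreal (F x * F y) \<le> b x y + b y x" for x y
  proof -
    have "0 \<le> (F x * v y - F y * v x)\<^sup>2" by simp
    then have "2 * (F x * F y) * (v x * v y) \<le> (F x)\<^sup>2 * (v y)\<^sup>2 + (F y)\<^sup>2 * (v x)\<^sup>2"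
      by (simp add: power2_diff power_mult_distrib mult_ac)
    then have "F x * F y \<le> (F x)\<^sup>2 / 2 * inverse (v x) * v y + (F y)\<^sup>2 / 2 * inverse (v y) * v x"
      using pos[of x] pos[of y] by (simp add: field_simps power2_eq_square)
    then have "ennreal (F x * F y) 
      \<le> ennreal ((F x)\<^sup>2 / 2 * inverse (v x) * v y) + ennreal ((F y)\<^sup>2 / 2 * inverse (v y) * v x)"
      using pos[of x] pos[of y] by (subst ennreal_plus[symmetric]) (simp_all only: ennreal_leI, simp_all)
    then have "a x y * ennreal (F x * F y) \<le> a x y * (ennreal ((F x)\<^sup>2 / 2 * inverse (v x) * v y) 
      + ennreal ((F y)\<^sup>2 / 2 * inverse (v y) * v x))"
      by (rule mult_left_mono) simp
    then show ?thesis by (simp add: b_def distrib_left sym[of y x])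
  qed
  have b_int: "(\<integral>\<^sup>+x. \<integral>\<^sup>+y. b x y \<partial>M \<partial>M) \<le> C * (\<integral>\<^sup>+x. ennreal ((F x)\<^sup>2 / 2) \<partial>M)"
  proof -
    have "(\<integral>\<^sup>+y. b x y \<partial>M) \<le> C * ennreal ((F x)\<^sup>2 / 2)" if x: "x \<in> space M" for x
    proof -
      note [measurable] = am[OF x] x
      have m1: "(\<lambda>y. a x y * ennreal (v y)) \<in> borel_measurable M"
        by measurable
      have m2: "(\<lambda>y. ennreal (inverse (v x)) * (a x y * ennreal (v y))) \<in> borel_measurable M"
        by measurable
      have split: "ennreal ((F x)\<^sup>2 / 2 * inverse (v x) * v y) 
          = ennreal ((F x)\<^sup>2 / 2) * ennreal (inverse (v x)) * ennreal (v y)" for y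
        using pos[of x] pos[of y] by (subst ennreal_mult[symmetric], simp, simp)+ simp
      have "(\<integral>\<^sup>+y. b x y \<partial>M) 
          = (\<integral>\<^sup>+y. ennreal ((F x)\<^sup>2 / 2) * (ennreal (inverse (v x)) * (a x y * ennreal (v y))) \<partial>M)"
        unfolding b_def split by (simp only: mult_ac)
      also have "\<dots> = ennreal ((F x)\<^sup>2 / 2) * (ennreal (inverse (v x)) * (\<integral>\<^sup>+y. a x y * ennreal (v y) \<partial>M))"
        by (simp only: nn_integral_cmult[OF m1] nn_integral_cmult[OF m2])
      also have "\<dots> \<le> ennreal ((F x)\<^sup>2 / 2) * C"
        by (rule mult_left_mono[OF bound]) simp
      finally show ?thesis by (simp add: mult.commute)
    qed
    then have "(\<integral>\<^sup>+x. \<integral>\<^sup>+y. b x y \<partial>M \<partial>M) \<le> (\<integral>\<^sup>+x. C * ennreal ((F x)\<^sup>2 / 2) \<partial>M)"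
      by (intro nn_integral_mono)
    also have "\<dots> = C * (\<integral>\<^sup>+x. ennreal ((F x)\<^sup>2 / 2) \<partial>M)"
      by (rule nn_integral_cmult) measurable
    finally show ?thesis .
  qed
  have "(\<integral>\<^sup>+x. \<integral>\<^sup>+y. a x y * ennreal (F x * F y) \<partial>M \<partial>M) \<le> (\<integral>\<^sup>+x. \<integral>\<^sup>+y. b x y + b y x \<partial>M \<partial>M)"
    by (intro nn_integral_mono le)
  also have "\<dots> = (\<integral>\<^sup>+x. (\<integral>\<^sup>+y. b x y \<partial>M) + (\<integral>\<^sup>+y. b y x \<partial>M) \<partial>M)"
    by (intro nn_integral_cong nn_integral_add bm bm')
  also have "\<dots> = (\<integral>\<^sup>+x. \<integral>\<^sup>+y. b x y \<partial>M \<partial>M) + (\<integral>\<^sup>+x. \<integral>\<^sup>+y. b y x \<partial>M \<partial>M)"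
    by (intro nn_integral_add inner_measurable b b')
  also have "(\<integral>\<^sup>+x. \<integral>\<^sup>+y. b y x \<partial>M \<partial>M) = (\<integral>\<^sup>+x. \<integral>\<^sup>+y. b x y \<partial>M \<partial>M)"
    by (rule Fubini'[OF b])
  also have "(\<integral>\<^sup>+x. \<integral>\<^sup>+y. b x y \<partial>M \<partial>M) + (\<integral>\<^sup>+x. \<integral>\<^sup>+y. b x y \<partial>M \<partial>M)
      \<le> C * (\<integral>\<^sup>+x. ennreal ((F x)\<^sup>2 / 2) \<partial>M) + C * (\<integral>\<^sup>+x. ennreal ((F x)\<^sup>2 / 2) \<partial>M)"
    by (intro add_mono b_int)
  also have "\<dots> = C * (\<integral>\<^sup>+x. ennreal ((F x)\<^sup>2 / 2) + ennreal ((F x)\<^sup>2 / 2) \<partial>M)"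
    by (subst nn_integral_add) (measurable, simp add: distrib_left)
  finally show ?thesis unfolding half .
qed

context berezin_quantization
begin

lemma overlap_measurable: "(\<lambda>p. cmod (cinner (k (fst p)) (k (snd p)))) \<in> borel_measurable (\<mu> \<Otimes>\<^sub>M \<mu>)"
  by (rule continuous_pair_measurable)
     (intro continuous_on_norm bounded_bilinear.continuous_on[OF bounded_bilinear_cinner]
       continuous_on_compose2[OF continuous_frame] continuous_intros subset_UNIV)

lemma near_measurable: "{p. dist (fst p) (snd p) < r} \<in> sets (\<mu> \<Otimes>\<^sub>M \<mu>)"
  by (rule open_pair_measurable) (intro open_Collect_less continuous_intros)

text \<open>On \<open>dist x y < r\<close> Schur's test is applied with the constant weight: there the kernel is
  controlled by the Berezin transform. Condition (ii) of the theorem controls the remaining part.\<close>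

lemma form_bound:
  fixes w :: "'x \<Rightarrow> real"
  assumes \<rho>: "symbol \<rho>" and w [measurable]: "w \<in> borel_measurable \<mu>" and w_pos: "\<And>x. w x > 0"
    and transform: "\<And>y. form \<rho> (k y) \<le> e"
    and far: "\<And>y. ennreal (inverse (w y)) *
             (\<integral>\<^sup>+x\<in>- ball y r. ennreal (cmod (cinner (k x) (k y)) * w x) \<partial>\<mu>) \<le> ennreal d"
    and s: "s > 0" and d: "d \<ge> 0"
  shows "(form \<rho> f)\<^sup>2 \<le> (e / (2 * s) + s * measure \<mu> (ball z r) / 2 + d) * (norm f) ^ 4"
proof -
  interpret sigma_finite_measure \<mu> by (rule sigma_finite)
  note [measurable] = symbol_measurable[OF \<rho>] overlap_measurable near_measurable
  define c where "c x y = cmod (cinner (k x) (k y))" for x y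
  define F where "F x = cmod (cinner f (k x))" for x
  define near far' :: "'x \<Rightarrow> 'x \<Rightarrow> ennreal" where
    "near x y = ennreal (\<rho> x * \<rho> y * c x y) * indicator {p. dist (fst p) (snd p) < r} (x, y)"
    and "far' x y = ennreal (\<rho> x * \<rho> y * c x y) * indicator (- {p. dist (fst p) (snd p) < r}) (x, y)" for x y
  have c_sym: "c x y = c y x" for x y
    unfolding c_def by (subst cinner_commute) simp
  have c_nonneg: "c x y \<ge> 0" for x y by (simp add: c_def)
  have c_meas [measurable]: "(\<lambda>y. c x y) \<in> borel_measurable \<mu>" "(\<lambda>y. c y x) \<in> borel_measurable \<mu>" for x
    unfolding c_def by measurable
  have c_pair [measurable]: "case_prod c \<in> borel_measurable (\<mu> \<Otimes>\<^sub>M \<mu>)"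
    using overlap_measurable by (simp add: c_def[abs_def] case_prod_beta)
  have F [measurable]: "F \<in> borel_measurable \<mu>"
    unfolding F_def by measurable
  have F0: "F x \<ge> 0" for x
    by (simp add: F_def)
  have FF: "(\<integral>\<^sup>+x. ennreal ((F x)\<^sup>2) \<partial>\<mu>) = ennreal ((norm f)\<^sup>2)"
    unfolding F_def frame_sq_integral[symmetric] by (rule nn_integral_eq_integral[OF frame_sq_integrable]) simp
  have near_meas [measurable]: "case_prod near \<in> borel_measurable (\<mu> \<Otimes>\<^sub>M \<mu>)"
    unfolding near_def case_prod_beta prod.collapse c_def by measurable
  have far_meas [measurable]: "case_prod far' \<in> borel_measurable (\<mu> \<Otimes>\<^sub>M \<mu>)"
    unfolding far'_def case_prod_beta prod.collapse c_def by measurable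
  have e0: "e \<ge> 0" using transform form_nonneg[OF \<rho>] order_trans by blast
  \<comment> \<open>From \<open>c \<le> c^2 / (2 * s) + s / 2\<close>: integrated against
    \<open>\<rho>\<close> over a ball of radius \<open>r\<close>, the first term is at most the
    Berezin transform over \<open>2 * s\<close>, the second at most \<open>s / 2\<close> times the
    measure of the ball, which is the same for all centres.\<close>
  define C1 where "C1 = e / (2 * s) + s * measure \<mu> (ball z r) / 2"
  have C1: "C1 \<ge> 0" using e0 s by (simp add: C1_def)
  have near_bound: "ennreal (inverse 1) * (\<integral>\<^sup>+y. near x y * ennreal 1 \<partial>\<mu>) \<le> ennreal C1" for x
  proof -
    have ball_int: "integrable \<mu> (indicator (ball x r) :: 'x \<Rightarrow> real)"
      using ball_finite[of x r] by (simp add: borel_measure)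
    have le: "near x y \<le> ennreal (1 / (2 * s) * (\<rho> y * (c x y)\<^sup>2) + s / 2 * indicator (ball x r) y)" for y
    proof (cases "dist x y < r")
      case True
      have "0 \<le> (c x y - s)\<^sup>2" by simp
      then have "c x y \<le> 1 / (2 * s) * (c x y)\<^sup>2 + s / 2"
        using s by (simp add: power2_diff field_simps power2_eq_square)
      then have "\<rho> y * c x y \<le> \<rho> y * (1 / (2 * s) * (c x y)\<^sup>2) + \<rho> y * (s / 2)"
        using symbol_nonneg[OF \<rho>, of y] by (metis distrib_left mult_left_mono)
      also have "\<rho> y * (s / 2) \<le> s / 2"
        using symbol_nonneg[OF \<rho>] symbol_le_1[OF \<rho>] s by (simp add: mult_left_le_one_le)
      finally have "\<rho> y * c x y \<le> 1 / (2 * s) * (\<rho> y * (c x y)\<^sup>2) + s / 2" by (simp add: mult_ac)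
      moreover have "\<rho> x * (\<rho> y * c x y) \<le> \<rho> y * c x y"
        using symbol_nonneg[OF \<rho>] symbol_le_1[OF \<rho>] c_nonneg by (simp add: mult_left_le_one_le)
      ultimately show ?thesis
        using True by (simp add: near_def mult.assoc ennreal_leI)
    qed (simp add: near_def)
    have "(\<integral>\<^sup>+y. near x y \<partial>\<mu>) 
      \<le> (\<integral>\<^sup>+y. ennreal (1 / (2 * s) * (\<rho> y * (c x y)\<^sup>2) + s / 2 * indicator (ball x r) y) \<partial>\<mu>)"
      by (rule nn_integral_mono[OF le])
    also have "\<dots> = ennreal (\<integral>y. 1 / (2 * s) * (\<rho> y * (c x y)\<^sup>2) + s / 2 * indicator (ball x r) y \<partial>\<mu>)"
      using form_integrable[OF \<rho>, of "k x"] ball_int s symbol_nonneg[OF \<rho>]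
      by (intro nn_integral_eq_integral Bochner_Integration.integrable_add integrable_mult_right AE_I2 add_nonneg_nonneg)
         (simp_all add: c_def)
    also have "(\<integral>y. 1 / (2 * s) * (\<rho> y * (c x y)\<^sup>2) + s / 2 * indicator (ball x r) y \<partial>\<mu>)
        = 1 / (2 * s) * form \<rho> (k x) + s / 2 * measure \<mu> (ball x r)"
      using form_integrable[OF \<rho>, of "k x"] ball_int by (simp add: form_def c_def borel_measure)
    also have "\<dots> \<le> C1"
      unfolding C1_def measure_ball_eq[of x r z] using transform[of x] s by (simp add: divide_right_mono)
    finally show ?thesis by (simp add: ennreal_leI)
  qed
  have far_bound: "ennreal (inverse (w x)) * (\<integral>\<^sup>+y. far' x y * ennreal (w y) \<partial>\<mu>) \<le> ennreal d" for x
  proof -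
    have "far' x y * ennreal (w y) \<le> ennreal (c y x * w y) * indicator (- ball x r) y" for y
    proof -
      have "\<rho> x * \<rho> y * c x y \<le> 1 * c x y"
        using symbol_nonneg[OF \<rho>] symbol_le_1[OF \<rho>] c_nonneg by (intro mult_right_mono mult_le_one) auto
      then have "ennreal (\<rho> x * \<rho> y * c x y) * ennreal (w y) \<le> ennreal (c y x) * ennreal (w y)"
        by (intro mult_right_mono ennreal_leI) (simp_all add: c_sym)
      also have "\<dots> = ennreal (c y x * w y)"
        using w_pos[of y] c_nonneg by (simp add: ennreal_mult)
      finally show ?thesis by (simp add: far'_def indicator_def)
    qed
    then have "(\<integral>\<^sup>+y. far' x y * ennreal (w y) \<partial>\<mu>) \<le> (\<integral>\<^sup>+y\<in>- ball x r. ennreal (c y x * w y) \<partial>\<mu>)"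
      by (rule nn_integral_mono)
    then show ?thesis
      using far[of x] unfolding c_def by (meson mult_left_mono order_trans zero_le)
  qed
  define T where "T = toeplitz \<mu> k \<rho> f"
  have T_frame: "ennreal (cmod (cinner T (k x))) \<le> (\<integral>\<^sup>+y. ennreal (\<rho> y * F y * c y x) \<partial>\<mu>)" for x
  proof -
    have "ennreal (cmod (cinner T (k x))) 
        \<le> (\<integral>\<^sup>+y. ennreal (cmod (complex_of_real (\<rho> y) * cinner f (k y) * cinner (k y) (k x))) \<partial>\<mu>)"
      unfolding T_def cinner_toeplitz[OF \<rho>] by (rule integral_norm_bound_ennreal[OF frame_product_integrable[OF \<rho>]])
    then show ?thesis
      by (simp add: norm_mult symbol_nonneg[OF \<rho>] F_def c_def)
  qed
  \<comment> \<open>Unfolding the Toeplitz operator once on each side of \<open>cinner T T\<close>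
    leads to a double integral with the symmetric kernel \<open>\<rho> x * \<rho> y * c x y\<close>,
    as Schur's test requires.\<close>
  have "ennreal ((norm T)\<^sup>2) = ennreal (cmod (cinner (toeplitz \<mu> k \<rho> f) T))"
    by (simp add: T_def[symmetric] cinner_self del: of_real_power)
  also have "\<dots> \<le> (\<integral>\<^sup>+x. ennreal (cmod (complex_of_real (\<rho> x) * cinner f (k x) * cinner (k x) T)) \<partial>\<mu>)"
    unfolding cinner_toeplitz[OF \<rho>] by (rule integral_norm_bound_ennreal[OF frame_product_integrable[OF \<rho>]])
  also have "\<dots> = (\<integral>\<^sup>+x. ennreal (\<rho> x * F x) * ennreal (cmod (cinner T (k x))) \<partial>\<mu>)"
    by (intro nn_integral_cong) (simp add: norm_mult symbol_nonneg[OF \<rho>] F_def cmod_frame_commute ennreal_mult[symmetric])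
  also have "\<dots> \<le> (\<integral>\<^sup>+x. ennreal (\<rho> x * F x) * (\<integral>\<^sup>+y. ennreal (\<rho> y * F y * c y x) \<partial>\<mu>) \<partial>\<mu>)"
    by (intro nn_integral_mono mult_left_mono T_frame) simp
  also have "\<dots> = (\<integral>\<^sup>+x. \<integral>\<^sup>+y. ennreal (\<rho> x * F x) * ennreal (\<rho> y * F y * c y x) \<partial>\<mu> \<partial>\<mu>)"
    by (intro nn_integral_cong nn_integral_cmult[symmetric]) measurable
  also have "\<dots> = (\<integral>\<^sup>+x. \<integral>\<^sup>+y. near x y * ennreal (F x * F y) + far' x y * ennreal (F x * F y) \<partial>\<mu> \<partial>\<mu>)"
  proof (intro nn_integral_cong)
    fix x y
    have "ennreal (\<rho> x * F x) * ennreal (\<rho> y * F y * c y x) = ennreal (\<rho> x * \<rho> y * c x y) * ennreal (F x * F y)"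
      using F0 c_nonneg symbol_nonneg[OF \<rho>] by (simp add: ennreal_mult[symmetric] c_sym[of y x] mult_ac)
    then show "ennreal (\<rho> x * F x) * ennreal (\<rho> y * F y * c y x) 
        = near x y * ennreal (F x * F y) + far' x y * ennreal (F x * F y)"
      by (simp add: near_def far'_def indicator_def)
  qed
  also have "\<dots> = (\<integral>\<^sup>+x. (\<integral>\<^sup>+y. near x y * ennreal (F x * F y) \<partial>\<mu>) + (\<integral>\<^sup>+y. far' x y * ennreal (F x * F y) \<partial>\<mu>) \<partial>\<mu>)"
    by (intro nn_integral_cong nn_integral_add) measurable
  also have "\<dots> = (\<integral>\<^sup>+x. \<integral>\<^sup>+y. near x y * ennreal (F x * F y) \<partial>\<mu> \<partial>\<mu>) 
      + (\<integral>\<^sup>+x. \<integral>\<^sup>+y. far' x y * ennreal (F x * F y) \<partial>\<mu> \<partial>\<mu>)"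
    by (rule nn_integral_add) measurable
  also have "\<dots> \<le> ennreal C1 * ennreal ((norm f)\<^sup>2) + ennreal d * ennreal ((norm f)\<^sup>2)"
    unfolding FF[symmetric]
  proof (rule add_mono)
    show "(\<integral>\<^sup>+x. \<integral>\<^sup>+y. near x y * ennreal (F x * F y) \<partial>\<mu> \<partial>\<mu>) \<le> ennreal C1 * (\<integral>\<^sup>+x. ennreal ((F x)\<^sup>2) \<partial>\<mu>)"
      by (rule schur_test[OF near_meas F _ _ _ near_bound])
         (auto simp: near_def c_sym dist_commute indicator_def mult_ac)
    show "(\<integral>\<^sup>+x. \<integral>\<^sup>+y. far' x y * ennreal (F x * F y) \<partial>\<mu> \<partial>\<mu>) \<le> ennreal d * (\<integral>\<^sup>+x. ennreal ((F x)\<^sup>2) \<partial>\<mu>)"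
      by (rule schur_test[OF far_meas F w w_pos _ far_bound])
         (auto simp: far'_def c_sym dist_commute indicator_def mult_ac)
  qed
  also have "\<dots> = ennreal ((C1 + d) * (norm f)\<^sup>2)"
    using C1 d by (simp add: ennreal_mult distrib_right)
  finally have T_le: "(norm T)\<^sup>2 \<le> (C1 + d) * (norm f)\<^sup>2"
    using C1 d by (simp add: ennreal_le_iff)
  have "complex_of_real (form \<rho> f) = cinner T f"
    by (simp add: T_def cinner_toeplitz_self[OF \<rho>])
  then have "form \<rho> f = cmod (cinner T f)"
    using form_nonneg[OF \<rho>, of f] by (metis abs_of_nonneg norm_of_real)
  also have "\<dots> \<le> norm T * norm f" by (rule norm_cinner_le)
  finally have "(form \<rho> f)\<^sup>2 \<le> (norm T)\<^sup>2 * (norm f)\<^sup>2"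
    using form_nonneg[OF \<rho>, of f] by (metis power_mono power_mult_distrib)
  also have "\<dots> \<le> (C1 + d) * (norm f)\<^sup>2 * (norm f)\<^sup>2"
    by (rule mult_right_mono[OF T_le]) simp
  finally show ?thesis by (simp add: C1_def power2_eq_square power4_eq_xxxx mult_ac)
qed

end

text \<open>Riesz's lemma with constant 1/2: take \<open>x\<close> in \<open>W\<close> outside
  \<open>V\<close>, a point \<open>a\<close> of \<open>V\<close> whose distance to \<open>x\<close>
  is less than twice the infimum, and normalise \<open>x - a\<close>.\<close>

lemma half_separated_unit_vector:
  fixes V W :: "'a::real_normed_vector set"
  assumes V: "subspace V" "closed V" and W: "subspace W" and "V \<subset> W"
  obtains u where "u \<in> W" "norm u = 1" "\<And>v. v \<in> V \<Longrightarrow> 1/2 \<le> norm (u - v)"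
proof -
  obtain x where x: "x \<in> W" "x \<notin> V" using \<open>V \<subset> W\<close> by blast
  define d where "d = infdist x V"
  have ne: "V \<noteq> {}" using subspace_0[OF V(1)] by blast
  have d: "d > 0"
    using in_closed_iff_infdist_zero[OF V(2) ne, of x] x infdist_nonneg[of x V] by (auto simp: d_def)
  obtain a where a: "a \<in> V" "dist x a < 2 * d"
  proof -
    have "(INF a\<in>V. dist x a) < 2 * d" using d ne by (simp add: d_def infdist_def)
    then show ?thesis using that ne by (subst (asm) cINF_less_iff) auto
  qed
  define n where "n = norm (x - a)"
  have n: "n > 0" "n < 2 * d" using a x(2) by (auto simp: n_def dist_norm)
  show ?thesis
  proof (rule that[of "(1 / n) *\<^sub>R (x - a)"])
    show "(1 / n) *\<^sub>R (x - a) \<in> W"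
      using x a \<open>V \<subset> W\<close> by (intro subspace_scale[OF W] subspace_diff[OF W]) auto
    show "norm ((1 / n) *\<^sub>R (x - a)) = 1" using n by (simp add: n_def)
    fix v assume "v \<in> V"
    then have "a + n *\<^sub>R v \<in> V" by (intro subspace_add[OF V(1)] subspace_scale[OF V(1)] a)
    then have "d \<le> norm (x - (a + n *\<^sub>R v))" unfolding d_def dist_norm[symmetric] by (rule infdist_le)
    also have "x - (a + n *\<^sub>R v) = n *\<^sub>R ((1 / n) *\<^sub>R (x - a) - v)"
      using n by (simp add: algebra_simps)
    finally have "d \<le> n * norm ((1 / n) *\<^sub>R (x - a) - v)" using n by simp
    moreover have "n * norm ((1 / n) *\<^sub>R (x - a) - v) \<le> 2 * d * norm ((1 / n) *\<^sub>R (x - a) - v)"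
      using n by (intro mult_right_mono) auto
    ultimately have "d * 1 \<le> d * (2 * norm ((1 / n) *\<^sub>R (x - a) - v))" by linarith
    then have "1 \<le> 2 * norm ((1 / n) *\<^sub>R (x - a) - v)" using d mult_le_cancel_left_pos by blast
    then show "1/2 \<le> norm ((1 / n) *\<^sub>R (x - a) - v)" by linarith
  qed
qed

section \<open>Thinness, and compactness of the forms of thin symbols\<close>

context berezin_quantization
begin

lemma thin_iff:
  assumes \<rho>: "symbol \<rho>"
  shows "thin \<mu> k \<rho> \<longleftrightarrow> (\<forall>z. \<forall>e>0. \<exists>R. \<forall>y. R \<le> dist z y \<longrightarrow> form \<rho> (k y) < e)"
proof -
  have "integrable \<mu> (\<lambda>x. \<rho> x * (cmod (cinner (k x) (k y)))\<^sup>2)" for y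
    using form_integrable[OF \<rho>, of "k y"] unfolding cmod_frame_commute[of _ "k y"] .
  then show ?thesis
    unfolding thin_def tendsto_iff eventually_filtercomap_at_top_linorder
    by (simp add: symbol_measurable[OF \<rho>] berezin_transform_eq_form form_nonneg[OF \<rho>])
qed

lemma thin_mono:
  assumes "symbol \<rho>" "symbol \<rho>'" "thin \<mu> k \<rho>'" "\<And>y. form \<rho> (k y) \<le> form \<rho>' (k y)"
  shows "thin \<mu> k \<rho>"
  using assms(3) unfolding thin_iff[OF assms(1)] thin_iff[OF assms(2)]
  by (meson assms(4) order_le_less_trans)

end

text \<open>The limit of suprema in condition (ii) is unpacked into one radius per tolerance that
  serves all \<open>y\<close>, the shape in which Schur's test consumes it.\<close>

locale decaying_frame = berezin_quantization G T \<phi> \<mu> k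
  for G (structure) and T and \<phi> :: "'g \<Rightarrow> 'x::metric_space \<Rightarrow> 'x" and \<mu> :: "'x measure" 
    and k :: "'x \<Rightarrow> 'h::chilbert_space" +
  fixes w :: "'x \<Rightarrow> real"
  assumes weight_measurable: "w \<in> borel_measurable \<mu>"
    and weight_pos: "w x > 0"
    and weighted_decay: "d > 0 \<Longrightarrow> \<exists>r. \<forall>y. ennreal (inverse (w y)) *
             (\<integral>\<^sup>+x\<in>- ball y r. ennreal (cmod (cinner (k x) (k y)) * w x) \<partial>\<mu>) \<le> ennreal d"
begin

text \<open>The converse direction to evaluating the form at \<open>k y\<close>: a uniformly small
  Berezin transform makes the whole form small. It matters that \<open>e\<close> depends on
  \<open>\<eta>\<close> alone and not on \<open>\<rho>\<close>. The three terms of the Schur bound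
  are each kept below \<open>h = \<eta>^2 / 3\<close>.\<close>

lemma form_small:
  assumes "\<eta> > 0"
  shows "\<exists>e>0. \<forall>\<rho>. symbol \<rho> \<longrightarrow> (\<forall>y. form \<rho> (k y) \<le> e) \<longrightarrow> (\<forall>f. form \<rho> f \<le> \<eta> * (norm f)\<^sup>2)"
proof -
  fix z :: 'x
  define h where "h = \<eta>\<^sup>2 / 3"
  have h: "h > 0" using assms by (simp add: h_def)
  obtain r where r: "\<And>y. ennreal (inverse (w y)) *
             (\<integral>\<^sup>+x\<in>- ball y r. ennreal (cmod (cinner (k x) (k y)) * w x) \<partial>\<mu>) \<le> ennreal h"
    using weighted_decay[OF h] by (elim exE) (rule that, erule spec)
  define m where "m = measure \<mu> (ball z r)"
  have m: "m \<ge> 0" by (simp add: m_def)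
  \<comment> \<open>The ball term \<open>s * m / 2\<close> is then at most \<open>h\<close>, with
    \<open>m + 1\<close> covering \<open>m = 0\<close>; the bound \<open>2 * s * h\<close> on the
    transform is what makes its term equal to \<open>h\<close>.\<close>
  define s where "s = 2 * h / (m + 1)"
  have s: "s > 0" using h m by (simp add: s_def)
  have sm: "s * m / 2 \<le> h" using h m by (simp add: s_def divide_le_eq algebra_simps)
  show ?thesis
  proof (intro exI[of _ "2 * s * h"] conjI allI impI)
    show "2 * s * h > 0" using s h by simp
    fix \<rho> f assume \<rho>: "symbol \<rho>" and small: "\<forall>y. form \<rho> (k y) \<le> 2 * s * h"
    have "(form \<rho> f)\<^sup>2 \<le> (2 * s * h / (2 * s) + s * measure \<mu> (ball z r) / 2 + h) * (norm f) ^ 4"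
      by (rule form_bound[OF \<rho> weight_measurable weight_pos _ r s]) (rule small[rule_format], rule less_imp_le[OF h])
    also have "\<dots> \<le> \<eta>\<^sup>2 * (norm f) ^ 4"
    proof (rule mult_right_mono)
      have "2 * s * h / (2 * s) = h" using s by simp
      moreover have "h + h + h = \<eta>\<^sup>2" by (simp add: h_def)
      ultimately show "2 * s * h / (2 * s) + s * measure \<mu> (ball z r) / 2 + h \<le> \<eta>\<^sup>2"
        using sm unfolding m_def by linarith
    qed simp
    also have "\<dots> = (\<eta> * (norm f)\<^sup>2)\<^sup>2" by (simp add: power2_eq_square power4_eq_xxxx mult_ac)
    finally show "form \<rho> f \<le> \<eta> * (norm f)\<^sup>2"
      by (rule power2_le_imp_le) (use assms in simp)
  qed
qed

text \<open>Cutting off a ball of radius \<open>R + r\<close> makes the Berezin transform small at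
  every \<open>y\<close>. For \<open>y\<close> beyond \<open>R\<close> this is thinness; for the
  other \<open>y\<close> the ball of radius \<open>r\<close> about \<open>y\<close> has been removed
  and only the uniform tail of \<open>k y\<close> is left.\<close>

lemma form_tail:
  assumes \<rho>: "symbol \<rho>" "thin \<mu> k \<rho>" and "\<eta> > 0"
  shows "\<exists>R. \<forall>f. form (\<lambda>x. \<rho> x * indicator (- ball z R) x) f \<le> \<eta> * (norm f)\<^sup>2"
proof -
  obtain e where e: "e > 0"
    "\<forall>\<rho>. symbol \<rho> \<longrightarrow> (\<forall>y. form \<rho> (k y) \<le> e) \<longrightarrow> (\<forall>f. form \<rho> f \<le> \<eta> * (norm f)\<^sup>2)"
    using form_small[OF \<open>\<eta> > 0\<close>] by (elim exE conjE) (rule that)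
  obtain R where R: "\<And>y. R \<le> dist z y \<Longrightarrow> form \<rho> (k y) < e"
    using iffD1[OF thin_iff[OF \<rho>(1)] \<rho>(2), THEN spec, THEN spec, THEN mp, OF e(1), of z] by auto
  obtain r where r: "\<And>y. form (indicator (- ball y r)) (k y) < e"
    using uniform_tail[OF e(1)] by metis
  have sym: "symbol (\<lambda>x. \<rho> x * indicator (- ball z (R + r)) x)"
    by (rule symbol_mult[OF \<rho>(1) symbol_compl_ball])
  have "form (\<lambda>x. \<rho> x * indicator (- ball z (R + r)) x) (k y) \<le> e" for y
  proof (cases "R \<le> dist z y")
    case True
    have "form (\<lambda>x. \<rho> x * indicator (- ball z (R + r)) x) (k y) \<le> form \<rho> (k y)"
      by (rule form_mono[OF sym \<rho>(1)]) (simp add: indicator_def symbol_nonneg[OF \<rho>(1)])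
    then show ?thesis using R[OF True] by simp
  next
    case False
    have "form (\<lambda>x. \<rho> x * indicator (- ball z (R + r)) x) (k y) \<le> form (indicator (- ball y r)) (k y)"
    proof (rule form_mono[OF sym symbol_compl_ball])
      fix x
      have "x \<in> ball y r \<Longrightarrow> x \<in> ball z (R + r)"
        using False dist_triangle[of z x y] by simp
      then show "\<rho> x * indicator (- ball z (R + r)) x \<le> indicator (- ball y r) x"
        using symbol_le_1[OF \<rho>(1), of x] by (auto simp: indicator_def)
    qed
    then show ?thesis using r[of y] by simp
  qed
  then have "\<forall>f. form (\<lambda>x. \<rho> x * indicator (- ball z (R + r)) x) f \<le> \<eta> * (norm f)\<^sup>2"
    by (intro e(2)[THEN spec, THEN mp, THEN mp, OF sym] allI)
  then show ?thesis ..
qed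

text \<open>Outside a ball the form is small uniformly on bounded sets. Inside, dominated
  convergence applies, with a constant bound on a set of finite measure.\<close>

lemma form_null_sequence:
  assumes \<rho>: "symbol \<rho>" "thin \<mu> k \<rho>" and bounded: "\<And>n. norm (g n) \<le> B"
    and pointwise: "\<And>x. (\<lambda>n. cinner (g n) (k x)) \<longlonglongrightarrow> 0"
  shows "(\<lambda>n. form \<rho> (g n)) \<longlonglongrightarrow> 0"
proof (rule metric_LIMSEQ_I)
  fix e :: real assume "e > 0"
  fix z :: 'x
  \<comment> \<open>Makes the tail at most \<open>e / 2\<close> for all vectors of norm at most
    \<open>B\<close>; the summand 1 covers \<open>B = 0\<close>.\<close>
  define \<eta> where "\<eta> = e / (2 * (B\<^sup>2 + 1))"
  have B: "0 < 2 * (B\<^sup>2 + 1)" by (simp add: add_nonneg_pos)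
  have \<eta>: "\<eta> > 0" using \<open>e > 0\<close> B by (simp add: \<eta>_def)
  obtain R where R: "\<And>f. form (\<lambda>x. \<rho> x * indicator (- ball z R) x) f \<le> \<eta> * (norm f)\<^sup>2"
    using form_tail[OF \<rho> \<eta>] by blast
  have sym1: "symbol (\<lambda>x. \<rho> x * indicator (ball z R) x)"
    by (rule symbol_mult[OF \<rho>(1) symbol_indicator]) simp
  have sym2: "symbol (\<lambda>x. \<rho> x * indicator (- ball z R) x)"
    by (rule symbol_mult[OF \<rho>(1) symbol_compl_ball])
  have "(\<lambda>n. \<integral>x. (\<rho> x * indicator (ball z R) x) * (cmod (cinner (g n) (k x)))\<^sup>2 \<partial>\<mu>) \<longlonglongrightarrow> (\<integral>x. 0 \<partial>\<mu>)"
  proof (rule integral_dominated_convergence)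
    show "integrable \<mu> (\<lambda>x. B\<^sup>2 * indicator (ball z R) x)"
      using ball_finite[of z R] by (simp add: borel_measure)
    show "(\<lambda>x. (\<rho> x * indicator (ball z R) x) * (cmod (cinner (g n) (k x)))\<^sup>2) \<in> borel_measurable \<mu>" for n
      using form_integrable[OF sym1] by (rule borel_measurable_integrable)
    show "AE x in \<mu>. (\<lambda>n. (\<rho> x * indicator (ball z R) x) * (cmod (cinner (g n) (k x)))\<^sup>2) \<longlonglongrightarrow> 0"
    proof (rule AE_I2)
      fix x
      have "(\<lambda>n. (\<rho> x * indicator (ball z R) x) * (cmod (cinner (g n) (k x)))\<^sup>2) 
          \<longlonglongrightarrow> (\<rho> x * indicator (ball z R) x) * (cmod 0)\<^sup>2"
        by (intro tendsto_intros pointwise)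
      then show "(\<lambda>n. (\<rho> x * indicator (ball z R) x) * (cmod (cinner (g n) (k x)))\<^sup>2) \<longlonglongrightarrow> 0" by simp
    qed
    show "AE x in \<mu>. norm ((\<rho> x * indicator (ball z R) x) * (cmod (cinner (g n) (k x)))\<^sup>2) 
        \<le> B\<^sup>2 * indicator (ball z R) x" for n
    proof (rule AE_I2)
      fix x
      have "(cmod (cinner (g n) (k x)))\<^sup>2 \<le> B\<^sup>2"
        using cmod_frame_le[of "g n" x] bounded[of n] by (intro power_mono) auto
      then have "\<rho> x * (cmod (cinner (g n) (k x)))\<^sup>2 \<le> 1 * B\<^sup>2"
        using symbol_nonneg[OF \<rho>(1)] symbol_le_1[OF \<rho>(1)] by (intro mult_mono) auto
      then show "norm ((\<rho> x * indicator (ball z R) x) * (cmod (cinner (g n) (k x)))\<^sup>2) 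
          \<le> B\<^sup>2 * indicator (ball z R) x"
        by (simp add: indicator_def symbol_nonneg[OF \<rho>(1)])
    qed
  qed simp
  then have "(\<lambda>n. form (\<lambda>x. \<rho> x * indicator (ball z R) x) (g n)) \<longlonglongrightarrow> 0"
    by (simp add: form_def)
  then have "\<forall>\<^sub>F n in sequentially. form (\<lambda>x. \<rho> x * indicator (ball z R) x) (g n) < e / 2"
    by (rule order_tendstoD) (use \<open>e > 0\<close> in simp)
  moreover have "form \<rho> (g n) < e" if "form (\<lambda>x. \<rho> x * indicator (ball z R) x) (g n) < e / 2" for n
  proof -
    have "form \<rho> (g n) \<le> form (\<lambda>x. \<rho> x * indicator (ball z R) x) (g n) 
        + form (\<lambda>x. \<rho> x * indicator (- ball z R) x) (g n)"
      by (rule form_add_le[OF \<rho>(1) sym1 sym2]) (simp add: indicator_def)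
    moreover have "\<eta> * (norm (g n))\<^sup>2 \<le> e / 2"
    proof -
      have "(norm (g n))\<^sup>2 \<le> B\<^sup>2" using bounded[of n] by (intro power_mono) auto
      then have "\<eta> * (norm (g n))\<^sup>2 \<le> \<eta> * (B\<^sup>2 + 1)" using \<eta> by (intro mult_left_mono) auto
      also have "\<dots> = e / 2" using B by (simp add: \<eta>_def field_simps)
      finally show ?thesis .
    qed
    ultimately show ?thesis using that R[of "g n"] by linarith
  qed
  ultimately have "\<forall>\<^sub>F n in sequentially. form \<rho> (g n) < e"
    by (auto elim: eventually_mono)
  then show "\<exists>N. \<forall>n\<ge>N. dist (form \<rho> (g n)) 0 < e"
    by (simp add: eventually_sequentially form_nonneg[OF \<rho>(1)])
qed

text \<open>A diagonal subsequence converges against \<open>k x\<close> for \<open>x\<close> in a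
  dense set, hence for all \<open>x\<close>, since \<open>k\<close> is continuous and the vectors
  are bounded. Differences of far terms are then null against the frame, so their
  \<open>\<rho>\<close>-form vanishes in the limit. Their \<open>(1 - \<rho>)\<close>-form does so
  by assumption, and the two forms add up to the squared norm.\<close>

lemma convergent_subsequence:
  assumes \<rho>: "symbol \<rho>" "thin \<mu> k \<rho>" and bounded: "\<And>n. norm (f n) \<le> B"
    and vanish: "(\<lambda>n. form (\<lambda>x. 1 - \<rho> x) (f n)) \<longlonglongrightarrow> 0"
  shows "\<exists>r l. strict_mono (r :: nat \<Rightarrow> nat) \<and> (f \<circ> r) \<longlonglongrightarrow> l"
proof -
  obtain D :: "'x set" where D: "countable D" "closure D = UNIV" using separable by blast
  obtain r :: "nat \<Rightarrow> nat" where r: "strict_mono r" 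
    and lim: "\<And>x. x \<in> D \<Longrightarrow> \<exists>l. (\<lambda>n. cinner (f (r n)) (k x)) \<longlonglongrightarrow> l"
  proof (rule function_convergent_subsequence[OF D(1), of "\<lambda>n x. cinner (f n) (k x)" B])
    show "norm (cinner (f n) (k x)) \<le> B" for n x
      using cmod_frame_le[of "f n" x] bounded[of n] by simp
  qed (use that in auto)
  have conv: "\<exists>l. (\<lambda>n. cinner (f (r n)) (k x)) \<longlonglongrightarrow> l" for x
  proof -
    have "Cauchy (\<lambda>n. cinner (f (r n)) (k x))"
    proof (rule metric_CauchyI)
      fix e :: real assume "e > 0"
      define e' where "e' = e / (3 * (\<bar>B\<bar> + 1))"
      have e': "e' > 0" using \<open>e > 0\<close> by (simp add: e'_def)
      obtain d where d: "d > 0" "\<And>y. dist y x < d \<Longrightarrow> dist (k y) (k x) < e'"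
        using continuous_frame e' unfolding continuous_on_iff by blast
      obtain y where y: "y \<in> D" "dist y x < d"
        using D(2) d(1) closure_approachable by (metis UNIV_I)
      have close: "dist (cinner (f n) (k x)) (cinner (f n) (k y)) \<le> e / 3" for n
      proof -
        have "dist (cinner (f n) (k x)) (cinner (f n) (k y)) \<le> norm (f n) * norm (k x - k y)"
          unfolding dist_norm cinner_diff_right[symmetric] by (rule norm_cinner_le)
        also have "\<dots> \<le> (\<bar>B\<bar> + 1) * e'"
          using d(2)[OF y(2)] bounded[of n] by (intro mult_mono) (auto simp: dist_norm norm_minus_commute)
        also have "\<dots> = e / 3" by (simp add: e'_def field_simps)
        finally show ?thesis .
      qed
      have "Cauchy (\<lambda>n. cinner (f (r n)) (k y))"
        using lim[OF y(1)] convergent_Cauchy convergent_def by blast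
      then obtain N where N: "\<And>i j. i \<ge> N \<Longrightarrow> j \<ge> N \<Longrightarrow> 
          dist (cinner (f (r i)) (k y)) (cinner (f (r j)) (k y)) < e / 3"
        using metric_CauchyD[of _ "e / 3"] \<open>e > 0\<close> by (metis divide_pos_pos zero_less_numeral)
      have "dist (cinner (f (r i)) (k x)) (cinner (f (r j)) (k x)) < e" if "i \<ge> N" "j \<ge> N" for i j
        using N[OF that] close[of "r i"] close[of "r j"]
          dist_triangle[of "cinner (f (r i)) (k x)" "cinner (f (r j)) (k x)" "cinner (f (r i)) (k y)"]
          dist_triangle2[of "cinner (f (r i)) (k y)" "cinner (f (r j)) (k x)" "cinner (f (r j)) (k y)"]
        by linarith
      then show "\<exists>N. \<forall>i\<ge>N. \<forall>j\<ge>N. dist (cinner (f (r i)) (k x)) (cinner (f (r j)) (k x)) < e" by blast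
    qed
    then show ?thesis using Cauchy_convergent_iff convergent_def by blast
  qed
  have "Cauchy (f \<circ> r)"
  proof (rule ccontr)
    assume "\<not> Cauchy (f \<circ> r)"
    then obtain e where e: "e > 0" 
      and far: "\<And>N. \<exists>i\<ge>N. \<exists>j\<ge>N. e \<le> dist (f (r i)) (f (r j))"
      unfolding Cauchy_def by (auto simp: not_less)
    then obtain p q where p: "\<And>N. p N \<ge> N" and q: "\<And>N. q N \<ge> N" 
      and pq: "\<And>N. e \<le> dist (f (r (p N))) (f (r (q N)))"
      by metis
    have lims: "filterlim p sequentially sequentially" "filterlim q sequentially sequentially"
      by (auto intro!: filterlim_at_top_mono[OF filterlim_ident] simp: p q)
    have rlim: "filterlim r sequentially sequentially" by (rule filterlim_subseq[OF r])
    define g where "g N = f (r (p N)) - f (r (q N))" for N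
    have "(\<lambda>N. form \<rho> (g N)) \<longlonglongrightarrow> 0"
    proof (rule form_null_sequence[OF \<rho>])
      show "norm (g N) \<le> 2 * B" for N
        using norm_triangle_ineq4[of "f (r (p N))" "f (r (q N))"] bounded[of "r (p N)"] bounded[of "r (q N)"]
        by (simp add: g_def)
      fix x
      obtain l where l: "(\<lambda>n. cinner (f (r n)) (k x)) \<longlonglongrightarrow> l" using conv by blast
      show "(\<lambda>N. cinner (g N) (k x)) \<longlonglongrightarrow> 0"
        using tendsto_diff[OF filterlim_compose[OF l lims(1)] filterlim_compose[OF l lims(2)]]
        by (simp add: g_def cinner_diff_left)
    qed
    moreover have "(\<lambda>N. form (\<lambda>x. 1 - \<rho> x) (g N)) \<longlonglongrightarrow> 0"
    proof (rule tendsto_sandwich)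
      show "\<forall>\<^sub>F N in sequentially. 0 \<le> form (\<lambda>x. 1 - \<rho> x) (g N)"
        by (simp add: form_nonneg[OF symbol_complement[OF \<rho>(1)]])
      show "\<forall>\<^sub>F N in sequentially. form (\<lambda>x. 1 - \<rho> x) (g N) 
          \<le> 2 * form (\<lambda>x. 1 - \<rho> x) (f (r (p N))) + 2 * form (\<lambda>x. 1 - \<rho> x) (f (r (q N)))"
        by (simp add: g_def form_diff_le[OF symbol_complement[OF \<rho>(1)]])
      have "(\<lambda>N. 2 * form (\<lambda>x. 1 - \<rho> x) (f (r (p N))) + 2 * form (\<lambda>x. 1 - \<rho> x) (f (r (q N)))) \<longlonglongrightarrow> 2 * 0 + 2 * 0"
        by (intro tendsto_intros filterlim_compose[OF vanish] filterlim_compose[OF rlim] lims)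
      then show "(\<lambda>N. 2 * form (\<lambda>x. 1 - \<rho> x) (f (r (p N))) + 2 * form (\<lambda>x. 1 - \<rho> x) (f (r (q N)))) \<longlonglongrightarrow> 0"
        by simp
    qed simp
    ultimately have "(\<lambda>N. form \<rho> (g N) + form (\<lambda>x. 1 - \<rho> x) (g N)) \<longlonglongrightarrow> 0 + 0"
      by (rule tendsto_add)
    then have "(\<lambda>N. (norm (g N))\<^sup>2) \<longlonglongrightarrow> 0"
      by (simp add: form_complement[OF \<rho>(1)])
    moreover have "e\<^sup>2 \<le> (norm (g N))\<^sup>2" for N
      using pq[of N] e by (simp add: g_def dist_norm power_mono)
    ultimately have "e\<^sup>2 \<le> 0" by (meson LIMSEQ_le_const)
    then show False using e by simp
  qed
  then show ?thesis using r Cauchy_convergent_iff convergent_def by blast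
qed

text \<open>Vanishing is demanded at every point, not almost everywhere: the space is then an
  intersection of closed kernels and moves exactly with \<open>S\<close> under translation.\<close>

definition supported :: "'x set \<Rightarrow> 'h set" where
  "supported S = {f. \<forall>x. x \<notin> S \<longrightarrow> cinner f (k x) = 0}"

lemma supported_mono: "S \<subseteq> S' \<Longrightarrow> supported S \<subseteq> supported S'"
  by (auto simp: supported_def)

lemma subspace_supported: "subspace (supported S)"
  by (auto simp: subspace_def supported_def cinner_add_left cinner_scaleR_left)

lemma closed_supported: "closed (supported S)"
proof -
  have "supported S = (\<Inter>x\<in>- S. {f. cinner f (k x) = 0})" by (auto simp: supported_def)
  also have "closed \<dots>"
    by (intro closed_INT ballI closed_Collect_eq bounded_bilinear.continuous_on[OF bounded_bilinear_cinner]
        continuous_intros)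
  finally show ?thesis .
qed

lemma form_supported: "f \<in> supported S \<Longrightarrow> form (\<lambda>x. 1 - indicator S x) f = 0"
proof -
  assume "f \<in> supported S"
  then have "(1 - indicator S x) * (cmod (cinner f (k x)))\<^sup>2 = 0" for x
    by (auto simp: supported_def indicator_def)
  then show ?thesis unfolding form_def by (simp only: Bochner_Integration.integral_zero)
qed

text \<open>The reproducing formula for \<open>cinner f (k x)\<close> only integrates over
  \<open>S\<close>. For thin \<open>S\<close> the bound yields decay at infinity, uniformly over the
  unit ball of \<open>supported S\<close>.\<close>

lemma cmod_supported_le:
  assumes "S \<in> sets borel" "f \<in> supported S"
  shows "cmod (cinner f (k x)) \<le> norm f * sqrt (form (indicator S) (k x))"
proof -
  have "cinner f (k x) = (\<integral>y. cinner f (k y) * cinner (k y) (k x) \<partial>\<mu>)"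
    using parseval_frame[of f] by (simp add: has_weak_integral_def cinner_scaleC_left)
  also have "\<dots> = (\<integral>y. complex_of_real (indicator S y) * cinner f (k y) * cinner (k y) (k x) \<partial>\<mu>)"
    using assms(2) by (intro Bochner_Integration.integral_cong) (auto simp: supported_def indicator_def)
  finally show ?thesis
    using frame_product_le[OF symbol_indicator[OF assms(1)], of f "k x"] by simp
qed

text \<open>A strict chain yields unit vectors at mutual distance at least 1/2. Being supported on
  \<open>S\<close> they have vanishing complementary form, so a convergent subsequence would
  exist.\<close>

lemma no_increasing_chain:
  assumes S: "S \<in> sets borel" "thin \<mu> k (indicator S)"
    and V: "\<And>n. subspace (V n)" "\<And>n. closed (V n)" "\<And>n. V n \<subset> V (Suc n)" "\<And>n. V n \<subseteq> supported S"
  shows False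
proof -
  have "\<exists>u. u \<in> V (Suc n) \<and> norm u = 1 \<and> (\<forall>v\<in>V n. 1/2 \<le> norm (u - v))" for n
    using half_separated_unit_vector[OF V(1,2) V(1) V(3), of n] by metis
  then have "\<exists>u. \<forall>n. u n \<in> V (Suc n) \<and> norm (u n) = 1 \<and> (\<forall>v\<in>V n. 1/2 \<le> norm (u n - v))"
    by (intro choice allI)
  then obtain u where "\<forall>n. u n \<in> V (Suc n) \<and> norm (u n) = 1 \<and> (\<forall>v\<in>V n. 1/2 \<le> norm (u n - v))" ..
  then have u: "u n \<in> V (Suc n)" "norm (u n) = 1" "v \<in> V n \<Longrightarrow> 1/2 \<le> norm (u n - v)" for n v
    by simp_all
  have mono: "V m \<subseteq> V n" if "m \<le> n" for m n
    by (rule lift_Suc_mono_le[of V, OF psubset_imp_subset[OF V(3)] that])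
  have "form (\<lambda>x. 1 - indicator S x) (u n) = 0" for n
    using form_supported u(1) V(4) by blast
  then obtain r l where r: "strict_mono (r :: nat \<Rightarrow> nat)" "(u \<circ> r) \<longlonglongrightarrow> l"
    using convergent_subsequence[OF symbol_indicator[OF S(1)] S(2), of u 1] u(2) by auto
  obtain N where N: "\<And>i j. i \<ge> N \<Longrightarrow> j \<ge> N \<Longrightarrow> dist (u (r i)) (u (r j)) < 1/2"
    using metric_CauchyD[OF LIMSEQ_imp_Cauchy[OF r(2)], of "1/2"] by auto
  \<comment> \<open>\<open>u n\<close> lies in \<open>V (Suc n)\<close> and is separated from
    \<open>V n\<close>; strict growth of the indices puts the earlier vector into the space from
    which the later one is separated.\<close>
  have "r N < r (Suc N)" using r(1) by (simp add: strict_mono_Suc_iff)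
  then have "u (r N) \<in> V (r (Suc N))" using u(1) mono[of "Suc (r N)" "r (Suc N)"] by auto
  then show False using u(3)[of "u (r N)" "r (Suc N)"] N[of "Suc N" N] by (simp add: dist_norm)
qed

end

section \<open>Translations\<close>

context berezin_quantization
begin

text \<open>The vector is the weak integral of
  \<open>cinner f (k x) *\<^sub>C k (\<phi> h x)\<close>, obtained by Riesz representation. Pairing
  it with \<open>k y\<close> and moving \<open>h\<close> to the other side requires the inner
  products themselves to be invariant, not only their moduli; the Parseval identity then evaluates
  the integral.\<close>

lemma translate_exists:
  assumes h: "h \<in> G_tau G \<phi> k"
  shows "\<exists>f'. \<forall>y. cinner f' (k y) = cinner f (k (\<phi> (inv h) y))"
proof -
  have hc: "h \<in> carrier G" and gram: "\<And>x y. cinner (k (\<phi> h x)) (k (\<phi> h y)) = cinner (k x) (k y)"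
    using h by (auto simp: G_tau_def)
  define I where "I g x = cinner f (k x) * cinner (k (\<phi> h x)) g" for g x
  have [measurable]: "(\<lambda>x. cinner (k (\<phi> h x)) g) \<in> borel_measurable \<mu>" for g
    using measurable_compose[OF action_measurable[OF hc] frame_inner_measurable'] .
  have sq_int: "integrable \<mu> (\<lambda>x. (cmod (cinner (k (\<phi> h x)) g))\<^sup>2)" for g
    using integrable_distr_eq[OF action_measurable[OF hc], of "\<lambda>x. (cmod (cinner g (k x)))\<^sup>2"]
      frame_sq_integrable[of g] unfolding distr_action[OF hc] cmod_frame_commute by simp
  have sq_val: "(\<integral>x. (cmod (cinner (k (\<phi> h x)) g))\<^sup>2 \<partial>\<mu>) = (norm g)\<^sup>2" for g
    using integral_action[OF hc, of "\<lambda>x. (cmod (cinner g (k x)))\<^sup>2"] frame_sq_integral[of g]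
    unfolding cmod_frame_commute by simp
  have norm_I: "norm (I g x) = cmod (cinner f (k x)) * cmod (cinner (k (\<phi> h x)) g)" for g x
    by (simp add: I_def norm_mult)
  have prod_int: "integrable \<mu> (\<lambda>x. cmod (cinner f (k x)) * cmod (cinner (k (\<phi> h x)) g))" for g
    by (rule integral_cauchy_schwarz(1)[OF _ _ frame_sq_integrable sq_int]) measurable
  have int: "integrable \<mu> (I g)" for g
    by (rule Bochner_Integration.integrable_bound[OF prod_int[of g]])
       (unfold I_def, measurable, simp add: norm_mult)
  have bound: "cmod (\<integral>x. I g x \<partial>\<mu>) \<le> norm f * norm g" for g
  proof -
    have "cmod (\<integral>x. I g x \<partial>\<mu>) \<le> (\<integral>x. cmod (cinner f (k x)) * cmod (cinner (k (\<phi> h x)) g) \<partial>\<mu>)"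
      using integral_norm_bound[of \<mu> "I g"] unfolding norm_I .
    also have "\<dots> \<le> sqrt (\<integral>x. (cmod (cinner f (k x)))\<^sup>2 \<partial>\<mu>) * sqrt (\<integral>x. (cmod (cinner (k (\<phi> h x)) g))\<^sup>2 \<partial>\<mu>)"
      by (rule integral_cauchy_schwarz(2)[OF _ _ frame_sq_integrable sq_int]) measurable
    also have "\<dots> = norm f * norm g" unfolding sq_val frame_sq_integral by simp
    finally show ?thesis .
  qed
  have add: "cnj (\<integral>x. I (g + g') x \<partial>\<mu>) = cnj (\<integral>x. I g x \<partial>\<mu>) + cnj (\<integral>x. I g' x \<partial>\<mu>)" for g g'
  proof -
    have "I (g + g') x = I g x + I g' x" for x by (simp add: I_def cinner_add_right distrib_left)
    then show ?thesis by (simp add: Bochner_Integration.integral_add[OF int int])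
  qed
  have scale: "cnj (\<integral>x. I (a *\<^sub>C g) x \<partial>\<mu>) = a * cnj (\<integral>x. I g x \<partial>\<mu>)" for a g
  proof -
    have "I (a *\<^sub>C g) x = cnj a * I g x" for x by (simp add: I_def cinner_scaleC_right)
    then show ?thesis by simp
  qed
  obtain f' where f': "\<And>g. cnj (\<integral>x. I g x \<partial>\<mu>) = cinner g f'"
    by (rule riesz_representation[of "\<lambda>g. cnj (\<integral>x. I g x \<partial>\<mu>)" "norm f"]) (simp_all add: add scale bound)
  have "cinner f' (k y) = cinner f (k (\<phi> (inv h) y))" for y
  proof -
    have "I (k y) x = cinner (cinner f (k x) *\<^sub>C k x) (k (\<phi> (inv h) y))" for x
      using gram[of x "\<phi> (inv h) y"] by (simp add: I_def cinner_scaleC_left action_inv'[OF hc])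
    then have "(\<integral>x. I (k y) x \<partial>\<mu>) = cinner f (k (\<phi> (inv h) y))"
      using parseval_frame[of f] by (simp add: has_weak_integral_def)
    then show ?thesis using f'[of "k y"] by (metis cinner_commute complex_cnj_cnj)
  qed
  then show ?thesis by blast
qed

text \<open>The choice is unambiguous, since a vector is determined by its inner products with the
  frame.\<close>

definition translate :: "'g \<Rightarrow> 'h \<Rightarrow> 'h" where
  "translate h f = (SOME f'. \<forall>y. cinner f' (k y) = cinner f (k (\<phi> (inv h) y)))"

lemma cinner_translate: 
  "h \<in> G_tau G \<phi> k \<Longrightarrow> cinner (translate h f) (k y) = cinner f (k (\<phi> (inv h) y))"
  using someI_ex[OF translate_exists, of h f] by (simp add: translate_def)

lemma translate_one: "\<one> \<in> G_tau G \<phi> k \<Longrightarrow> translate \<one> f = f"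
  by (rule frame_eqI) (simp add: cinner_translate action_one)

lemma translate_mult:
  assumes "g \<in> G_tau G \<phi> k" "h \<in> G_tau G \<phi> k" "g \<otimes> h \<in> G_tau G \<phi> k"
  shows "translate (g \<otimes> h) f = translate g (translate h f)"
proof (rule frame_eqI)
  have "g \<in> carrier G" "h \<in> carrier G" using assms by (auto simp: G_tau_def)
  then show "cinner (translate (g \<otimes> h) f) (k x) = cinner (translate g (translate h f)) (k x)" for x
    by (simp add: cinner_translate assms inv_mult_group action_mult)
qed

lemma norm_translate:
  assumes h: "h \<in> G_tau G \<phi> k"
  shows "norm (translate h f) = norm f"
proof -
  have hc: "inv h \<in> carrier G" using h by (simp add: G_tau_def)
  have "(norm (translate h f))\<^sup>2 = (norm f)\<^sup>2"
    unfolding frame_sq_integral[symmetric] cinner_translate[OF h]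
    by (rule integral_action[OF hc]) measurable
  then show ?thesis by (simp add: power2_eq_iff_nonneg)
qed

section \<open>Translates of thin open sets\<close>

lemma open_action_image: "h \<in> carrier G \<Longrightarrow> open S \<Longrightarrow> open (\<phi> h ` S)"
  using action_isometry_continuous[of "inv h" UNIV] by (simp add: action_image continuous_on_open_vimage)

lemma form_action_image:
  assumes h: "h \<in> carrier G" and S: "S \<in> sets borel"
  shows "form (indicator (\<phi> h ` S)) (k y) = form (indicator S) (k (\<phi> (inv h) y))"
proof -
  have "indicator (\<phi> h ` S) x = (indicator S (\<phi> (inv h) x) :: real)" for x
    unfolding action_image[OF h] by (simp add: indicator_def)
  then have "indicator (\<phi> h ` S) = (\<lambda>x. indicator S (\<phi> (inv h) x) :: real)" by blast
  then show ?thesis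
    using form_translate[OF _ symbol_indicator[OF S], of "inv h" y] h by simp
qed

text \<open>The base point is moved along: the distance from \<open>z\<close> to \<open>y\<close>
  equals that from \<open>\<phi> (inv h) z\<close> to \<open>\<phi> (inv h) y\<close>.\<close>

lemma thin_action_image:
  assumes h: "h \<in> carrier G" and S: "open S" and thin: "thin \<mu> k (indicator S)"
  shows "thin \<mu> k (indicator (\<phi> h ` S))"
proof -
  have S': "S \<in> sets borel" "\<phi> h ` S \<in> sets borel" using S open_action_image[OF h S] by simp_all
  show ?thesis
    unfolding thin_iff[OF symbol_indicator[OF S'(2)]]
  proof (intro allI impI)
    fix z :: 'x and e :: real assume "e > 0"
    then obtain R where R: "\<And>y. R \<le> dist (\<phi> (inv h) z) y \<Longrightarrow> form (indicator S) (k y) < e"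
      using thin unfolding thin_iff[OF symbol_indicator[OF S'(1)]] by metis
    have "form (indicator (\<phi> h ` S)) (k y) < e" if "R \<le> dist z y" for y
      unfolding form_action_image[OF h S'(1)] by (rule R) (use that dist_invariant[of "inv h" z y] h in simp)
    then show "\<exists>R. \<forall>y. R \<le> dist z y \<longrightarrow> form (indicator (\<phi> h ` S)) (k y) < e" by blast
  qed
qed

text \<open>The points whose ball of radius \<open>1 / (n + 1)\<close> lies in \<open>U\<close> form
  a closed bounded set, compact by properness. These sets exhaust the open set \<open>U\<close>,
  which has finite measure, so the remainders shrink to measure zero.\<close>

lemma inner_compact:
  assumes U: "open U" "U \<subseteq> ball z r" and "e > 0"
  obtains K where "compact K" "K \<subseteq> U" "measure \<mu> (U - K) < e"
proof -
  define K where "K n = {x. ball x (inverse (real (Suc n))) \<subseteq> U}" for n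
  have sub: "K n \<subseteq> U" for n
    by (auto simp: K_def subset_iff)
  have "closed (K n)" for n
  proof -
    define r where "r = inverse (real (Suc n))"
    have "open (- K n)"
      unfolding open_dist
    proof
      fix x assume "x \<in> - K n"
      then obtain u where u: "dist x u < r" "u \<notin> U" by (auto simp: K_def r_def subset_iff)
      have "y \<in> - K n" if "dist y x < r - dist x u" for y
      proof -
        have "dist y u < r" using that dist_triangle[of y u x] by linarith
        then show ?thesis using u(2) by (auto simp: K_def r_def subset_iff)
      qed
      then show "\<exists>e>0. \<forall>y. dist y x < e \<longrightarrow> y \<in> - K n"
        using u(1) by (intro exI[of _ "r - dist x u"]) auto
    qed
    then show ?thesis by (simp add: closed_def)
  qed
  moreover have "K n \<subseteq> closure (ball z r)" for n
    using sub U(2) closure_subset by blast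
  ultimately have K_compact: "compact (K n)" for n
    using compact_Int_closed[OF proper_metric, of "K n" z r] by (simp add: Int_absorb1)
  have fin: "emeasure \<mu> (U - K n) < \<infinity>" for n
  proof -
    have "emeasure \<mu> (U - K n) \<le> emeasure \<mu> (ball z r)"
      using U(2) by (intro emeasure_mono) (auto simp: borel_measure)
    then show ?thesis using ball_finite[of z r] by (rule order_le_less_trans)
  qed
  have "(\<lambda>n. measure \<mu> (U - K n)) \<longlonglongrightarrow> measure \<mu> (\<Inter>n. U - K n)"
  proof (rule Lim_measure_decseq)
    show "range (\<lambda>n. U - K n) \<subseteq> sets \<mu>"
      using U(1) K_compact by (auto simp: borel_measure sets.Diff borel_compact)
    have "K m \<subseteq> K n" if "m \<le> n" for m n
    proof -
      have "ball x (inverse (real (Suc n))) \<subseteq> ball x (inverse (real (Suc m)))" for x :: 'x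
        using that by (intro subset_ball) (simp add: field_simps)
      then show ?thesis unfolding K_def by blast
    qed
    then show "decseq (\<lambda>n. U - K n)" unfolding decseq_def by blast
    show "emeasure \<mu> (U - K n) \<noteq> \<infinity>" for n using fin[of n] by simp
  qed
  moreover have "(\<Inter>n. U - K n) = {}"
  proof -
    have "\<exists>n. x \<in> K n" if xU: "x \<in> U" for x
    proof -
      obtain d where d: "d > 0" "ball x d \<subseteq> U" by (rule openE[OF U(1) xU])
      obtain n where n: "inverse (real (Suc n)) < d" using reals_Archimedean[OF d(1)] by blast
      have "ball x (inverse (real (Suc n))) \<subseteq> ball x d" using n by (intro subset_ball) simp
      then have "x \<in> K n" using d(2) by (auto simp: K_def)
      then show ?thesis ..
    qed
    then show ?thesis by auto
  qed
  ultimately have "(\<lambda>n. measure \<mu> (U - K n)) \<longlonglongrightarrow> 0"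
    by (simp only: measure_empty)
  then have "\<forall>\<^sub>F n in sequentially. measure \<mu> (U - K n) < e"
    by (rule order_tendstoD) (rule \<open>e > 0\<close>)
  then obtain n where "measure \<mu> (U - K n) < e"
    using eventually_happens'[OF sequentially_bot] by blast
  then show ?thesis using that[OF K_compact sub] by simp
qed

text \<open>Far from the base point \<open>h S - S\<close> is controlled by thinness. In a ball, \<open>S\<close> is a compact
  set up to small measure, and the open set \<open>S\<close> still contains the translate of that compact set.\<close>

lemma form_translated_difference_small:
  assumes S: "open S" and thin: "thin \<mu> k (indicator S)" and "e > 0"
  obtains N where "openin T N" "\<one> \<in> N" "\<And>h y. h \<in> N \<Longrightarrow> form (indicator (\<phi> h ` S - S)) (k y) < e"
proof -
  fix z :: 'x
  have Sb: "S \<in> sets borel" using S by simp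
  obtain R where R: "\<And>y. R \<le> dist z y \<Longrightarrow> form (indicator S) (k y) < e"
    using thin \<open>e > 0\<close> unfolding thin_iff[OF symbol_indicator[OF Sb]] by metis
  obtain r where r: "\<And>y. form (indicator (- ball y r)) (k y) < e / 2"
    using uniform_tail[of "e / 2"] \<open>e > 0\<close> by (metis half_gt_zero)
  \<comment> \<open>In the near case \<open>dist z y < R + 1\<close>, so \<open>ball y r\<close>
    lies in \<open>ball z q\<close>. The further unit in \<open>U\<close> allows for
    \<open>h\<close>, which moves \<open>z\<close> by less than 1.\<close>
  define q where "q = R + 1 + r"
  define U where "U = S \<inter> ball z (q + 1)"
  have U: "open U" "U \<subseteq> ball z (q + 1)" using S by (auto simp: U_def)
  obtain K where K: "compact K" "K \<subseteq> U" "measure \<mu> (U - K) < e / 2"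
    using inner_compact[OF U, of "e / 2"] \<open>e > 0\<close> by (metis half_gt_zero)
  \<comment> \<open>Tube lemma for the action: the identity keeps the compact set \<open>K\<close>
    inside the open set \<open>S\<close>, hence so does a whole neighbourhood of it.\<close>
  define W where "W = {p \<in> topspace (prod_topology T euclidean). (case p of (h, x) \<Rightarrow> \<phi> h x) \<in> S}"
  have "openin (prod_topology T euclidean) W"
    unfolding W_def by (rule openin_continuous_map_preimage[OF continuous_action]) (use S in simp)
  moreover have "{\<one>} \<times> K \<subseteq> W"
    using K(2) by (auto simp: W_def U_def topspace_eq action_one)
  ultimately obtain N1 V where N1: "openin T N1" "\<one> \<in> N1" "K \<subseteq> V" "N1 \<times> V \<subseteq> W"
    using tube_lemma_right[of T euclidean W K \<one>] K(1) by (auto simp: topspace_eq)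
  have N1_image: "\<phi> h ` K \<subseteq> S" if "h \<in> N1" for h
  proof -
    have "(h, x) \<in> W" if "x \<in> K" for x using N1(3,4) \<open>h \<in> N1\<close> that by blast
    then show ?thesis by (auto simp: W_def)
  qed
  define W' where "W' = {p \<in> topspace (prod_topology T euclidean). (case p of (h, x) \<Rightarrow> \<phi> h x) \<in> ball z 1}"
  have "openin (prod_topology T euclidean) W'"
    unfolding W'_def by (rule openin_continuous_map_preimage[OF continuous_action]) simp
  moreover have "{\<one>} \<times> {z} \<subseteq> W'"
    by (auto simp: W'_def topspace_eq action_one)
  ultimately obtain N2 V' where N2: "openin T N2" "\<one> \<in> N2" "{z} \<subseteq> V'" "N2 \<times> V' \<subseteq> W'"
    using tube_lemma_right[of T euclidean W' "{z}" \<one>] by (auto simp: topspace_eq)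
  have N2_dist: "dist z (\<phi> h z) < 1" if "h \<in> N2" for h
    using N2(3,4) that by (auto simp: W'_def)
  show ?thesis
  proof (rule that[of "N1 \<inter> N2"])
    show "openin T (N1 \<inter> N2)" "\<one> \<in> N1 \<inter> N2" using N1 N2 by auto
    fix h y assume hN: "h \<in> N1 \<inter> N2"
    then have h: "h \<in> carrier G" using openin_subset[OF N1(1)] topspace_eq by blast
    have hd: "dist z (\<phi> h z) < 1" using N2_dist hN by blast
    have hS: "open (\<phi> h ` S)" using open_action_image[OF h S] .
    have sym: "symbol (indicator (\<phi> h ` S - S))" using hS S by (intro symbol_indicator) simp
    show "form (indicator (\<phi> h ` S - S)) (k y) < e"
    \<comment> \<open>The margin 1 keeps \<open>\<phi> (inv h) y\<close> at distance at least
      \<open>R\<close> from \<open>z\<close>, where thinness of \<open>S\<close> applies.\<close>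
    proof (cases "R + 1 \<le> dist z y")
      case True
      have "form (indicator (\<phi> h ` S - S)) (k y) \<le> form (indicator (\<phi> h ` S)) (k y)"
        using hS by (intro form_mono[OF sym symbol_indicator]) (auto simp: indicator_def)
      also have "\<dots> = form (indicator S) (k (\<phi> (inv h) y))" by (rule form_action_image[OF h Sb])
      also have "\<dots> < e"
      proof (rule R)
        have "dist z (\<phi> (inv h) y) = dist (\<phi> h z) y"
          using dist_invariant[OF h, of z "\<phi> (inv h) y"] by (simp add: action_inv'[OF h])
        then show "R \<le> dist z (\<phi> (inv h) y)"
          using True hd dist_triangle[of z y "\<phi> h z"] by linarith
      qed
      finally show ?thesis .
    next
      case False
      define Y where "Y = (\<phi> h ` S - S) \<inter> ball z q"
      have Y: "Y \<in> sets borel" using hS S by (simp add: Y_def)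
      have near: "form (indicator (\<phi> h ` S - S)) (k y) \<le> form (indicator (- ball y r)) (k y) + form (indicator Y) (k y)"
      proof (rule form_add_le[OF sym symbol_compl_ball symbol_indicator[OF Y]])
        fix x
        have "x \<in> ball y r \<Longrightarrow> x \<in> ball z q"
          using False dist_triangle[of z x y] by (simp add: q_def)
        then show "indicator (\<phi> h ` S - S) x \<le> indicator (- ball y r) x + (indicator Y x :: real)"
          by (auto simp: indicator_def Y_def)
      qed
      \<comment> \<open>A point of \<open>Y\<close> comes from some \<open>u\<close> in
        \<open>S\<close>; were \<open>u\<close> in \<open>K\<close>, its image would lie in
        \<open>S\<close>, which \<open>Y\<close> avoids.\<close>
      have Ysub: "Y \<subseteq> \<phi> h ` (U - K)"
      proof
        fix x assume x: "x \<in> Y"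
        then obtain u where u: "u \<in> S" "x = \<phi> h u" by (auto simp: Y_def)
        have "dist z u = dist (\<phi> h z) x" using u(2) dist_invariant[OF h] by simp
        then have "dist z u < q + 1"
          using x hd dist_triangle[of "\<phi> h z" x z] by (simp add: Y_def dist_commute)
        moreover have "u \<notin> K" using N1_image[of h] hN u x by (auto simp: Y_def)
        ultimately show "x \<in> \<phi> h ` (U - K)" using u by (auto simp: U_def)
      qed
      have UK: "U - K \<in> sets \<mu>" using U(1) K(1) by (simp add: borel_measure sets.Diff borel_compact)
      have fin: "emeasure \<mu> (\<phi> h ` (U - K)) < \<infinity>"
      proof -
        have "emeasure \<mu> (U - K) \<le> emeasure \<mu> (ball z (q + 1))"
          using U by (intro emeasure_mono) (auto simp: borel_measure)
        then show ?thesis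
          using ball_finite[of z "q + 1"] measure_invariant[OF h UK] by simp
      qed
      have im: "\<phi> h ` (U - K) \<in> sets \<mu>"
        using measurable_sets[OF action_measurable[of "inv h"] UK] h by (simp add: action_image)
      have "form (indicator Y) (k y) \<le> (\<integral>x. indicator (\<phi> h ` (U - K)) x \<partial>\<mu>)"
        unfolding form_def
      proof (rule integral_mono[OF form_integrable[OF symbol_indicator[OF Y]]])
        show "integrable \<mu> (indicator (\<phi> h ` (U - K)) :: 'x \<Rightarrow> real)" using fin im by simp
        fix x
        have "(cmod (cinner (k y) (k x)))\<^sup>2 \<le> 1"
          using cmod_frame_le[of "k y" x] by (simp add: normalized_frame power_le_one)
        then show "indicator Y x * (cmod (cinner (k y) (k x)))\<^sup>2 \<le> (indicator (\<phi> h ` (U - K)) x :: real)"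
          using Ysub by (auto simp: indicator_def)
      qed
      also have "\<dots> = measure \<mu> (U - K)"
        using im measure_invariant[OF h UK] by (simp add: measure_def)
      finally show ?thesis using near r[of y] K(3) by linarith
    qed
  qed
qed

end

section \<open>Growing supports\<close>

context decaying_frame
begin

lemma translate_supported:
  assumes "h \<in> G_tau G \<phi> k" "f \<in> supported S"
  shows "translate h f \<in> supported (\<phi> h ` S)"
  unfolding supported_def
proof (intro CollectI allI impI)
  fix x assume x: "x \<notin> \<phi> h ` S"
  have h: "h \<in> carrier G" using assms(1) by (simp add: G_tau_def)
  have "\<phi> (inv h) x \<notin> S" using x by (simp add: action_image[OF h])
  then show "cinner (translate h f) (k x) = 0"
    using assms(2) by (simp add: cinner_translate[OF assms(1)] supported_def)
qed

text \<open>Otherwise the stabiliser of \<open>supported S\<close> in \<open>A\<close> is an open, hence closed, subgroup of \<open>A\<close>.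
  Since \<open>cmod (cinner f (k x))\<close> is small far out, uniformly over the unit ball of \<open>supported S\<close>, the
  orbits of the stabiliser are bounded, so it is compact.\<close>

lemma support_not_stable:
  assumes S: "open S" and thin: "thin \<mu> k (indicator S)"
    and f0: "f0 \<in> supported S" "f0 \<noteq> 0"
    and A: "subgroup A G" and A_tau: "A \<subseteq> G_tau G \<phi> k" and A_proper: "acts_properly T \<phi> A"
    and A_acc: "\<one> \<in> T derived_set_of A"
    and A_no_compact: "\<And>K. subgroup K G \<Longrightarrow> K \<subseteq> A \<Longrightarrow> compactin T K \<Longrightarrow> K = {\<one>}"
    and N: "openin T N" "\<one> \<in> N"
  shows "\<exists>h\<in>N \<inter> A. \<exists>f\<in>supported S. translate h f \<notin> supported S"
proof (rule ccontr)
  assume "\<not> ?thesis"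
  then have stable: "\<And>h f. h \<in> N \<Longrightarrow> h \<in> A \<Longrightarrow> f \<in> supported S \<Longrightarrow> translate h f \<in> supported S"
    by blast
  interpret A: subgroup A G by (rule A)
  have Sb: "S \<in> sets borel" using S by simp
  have Ac: "h \<in> A \<Longrightarrow> h \<in> carrier G" for h using A.subset by blast
  have At: "h \<in> A \<Longrightarrow> h \<in> G_tau G \<phi> k" for h using A_tau by blast
  \<comment> \<open>Both \<open>h\<close> and its inverse are required to preserve the space, so
    that \<open>B\<close> is closed under inversion by definition.\<close>
  define B where "B = {h \<in> A. \<forall>f\<in>supported S. translate h f \<in> supported S \<and> translate (inv h) f \<in> supported S}"
  have B_sub: "B \<subseteq> A" by (auto simp: B_def)
  have mult: "translate (g \<otimes> h) f = translate g (translate h f)" if "g \<in> A" "h \<in> A" for g h f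
    using that by (intro translate_mult At) simp_all
  have B_subgroup: "subgroup B G"
  proof
    show "B \<subseteq> carrier G" using B_sub Ac by blast
    show "\<one> \<in> B" by (auto simp: B_def translate_one At)
    show "inv g \<in> B" if "g \<in> B" for g using that Ac by (auto simp: B_def)
    show "g \<otimes> h \<in> B" if "g \<in> B" "h \<in> B" for g h
      using that Ac by (auto simp: B_def mult inv_mult_group)
  qed
  interpret B: subgroup B G by (rule B_subgroup)
  \<comment> \<open>Symmetrising the neighbourhood puts all of its elements that belong to
    \<open>A\<close> into \<open>B\<close>.\<close>
  define N' where "N' = N \<inter> {h \<in> topspace T. inv h \<in> N}"
  have N': "openin T N'" "\<one> \<in> N'"
    unfolding N'_def using N openin_continuous_map_preimage[OF continuous_inv N(1)]
    by (auto simp: topspace_eq)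
  have N'_B: "h \<in> B" if "h \<in> N'" "h \<in> A" for h
    using that stable by (auto simp: B_def N'_def)
  have B_closed: "closedin (subtopology T A) B"
    unfolding closedin_def
  proof
    have top: "topspace (subtopology T A) = A"
      using A.subset by (auto simp: topspace_eq)
    show "B \<subseteq> topspace (subtopology T A)" using B_sub top by simp
    show "openin (subtopology T A) (topspace (subtopology T A) - B)"
      unfolding top
    proof (subst openin_subopen, intro ballI)
      fix h assume h: "h \<in> A - B"
      \<comment> \<open>The translate of \<open>N'\<close> by \<open>h\<close>. If it met
        \<open>B\<close> in an element \<open>g\<close> of \<open>A\<close>, then
        \<open>inv h \<otimes> g\<close> would be in \<open>B\<close> and hence \<open>h\<close> as
        well; so the complement of \<open>B\<close> in \<open>A\<close> is open.\<close>
      define U where "U = {g \<in> topspace T. inv h \<otimes> g \<in> N'}"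
      have "continuous_map T T (\<lambda>g. inv h \<otimes> g)"
      proof -
        have "continuous_map T (prod_topology T T) (\<lambda>g. (inv h, g))"
          using h Ac by (auto intro!: continuous_map_pairedI simp: topspace_eq)
        from continuous_map_compose[OF this continuous_mult] show ?thesis by (simp add: o_def)
      qed
      then have U: "openin T U" unfolding U_def by (rule openin_continuous_map_preimage) (rule N'(1))
      show "\<exists>V. openin (subtopology T A) V \<and> h \<in> V \<and> V \<subseteq> A - B"
      proof (intro exI[of _ "U \<inter> A"] conjI)
        show "openin (subtopology T A) (U \<inter> A)" using U by (auto simp: openin_subtopology)
        show "h \<in> U \<inter> A" using h Ac N'(2) by (simp add: U_def topspace_eq)
        show "U \<inter> A \<subseteq> A - B"
        proof
          fix g assume g: "g \<in> U \<inter> A"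
          have "g \<notin> B"
          proof
            assume gB: "g \<in> B"
            have "inv h \<otimes> g \<in> B" using g h by (intro N'_B) (auto simp: U_def)
            then have "g \<otimes> inv (inv h \<otimes> g) \<in> B" using gB by simp
            moreover have "g \<otimes> inv (inv h \<otimes> g) = h"
              using g h Ac by (simp add: inv_mult_group flip: m_assoc)
            ultimately show False using h by simp
          qed
          then show "g \<in> A - B" using g by simp
        qed
      qed
    qed
  qed
  obtain x0 where x0: "cinner f0 (k x0) \<noteq> 0" using f0(2) frame_separates by blast
  define c where "c = (cmod (cinner f0 (k x0)) / norm f0)\<^sup>2"
  have c: "c > 0" using x0 f0(2) by (simp add: c_def)
  obtain R where R: "\<And>y. R \<le> dist x0 y \<Longrightarrow> form (indicator S) (k y) < c"
    using thin c unfolding thin_iff[OF symbol_indicator[OF Sb]] by metis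
  \<comment> \<open>The value of the translated vector at \<open>\<phi> h x0\<close> is that of
    \<open>f0\<close> at \<open>x0\<close>, independently of \<open>h\<close>. The decay of
    supported vectors therefore forbids \<open>\<phi> h x0\<close> to be far from
    \<open>x0\<close>.\<close>
  have orbit: "\<phi> h x0 \<in> closure (ball x0 R)" if h: "h \<in> B" for h
  proof -
    have hA: "h \<in> A" using h B_sub by blast
    have "translate h f0 \<in> supported S" using h f0(1) by (simp add: B_def)
    from cmod_supported_le[OF Sb this, of "\<phi> h x0"]
    have "cmod (cinner f0 (k x0)) \<le> norm f0 * sqrt (form (indicator S) (k (\<phi> h x0)))"
      using hA by (simp add: cinner_translate At norm_translate action_inv Ac)
    then have "cmod (cinner f0 (k x0)) / norm f0 \<le> sqrt (form (indicator S) (k (\<phi> h x0)))"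
      using f0(2) by (simp add: divide_le_eq mult.commute)
    then have "c \<le> (sqrt (form (indicator S) (k (\<phi> h x0))))\<^sup>2"
      unfolding c_def by (rule power_mono) simp
    then have "c \<le> form (indicator S) (k (\<phi> h x0))"
      using form_nonneg[OF symbol_indicator[OF Sb]] by simp
    then have "dist x0 (\<phi> h x0) < R" using R[of "\<phi> h x0"] by linarith
    then show ?thesis by (intro subsetD[OF closure_subset]) simp
  qed
  \<comment> \<open>The preimage of this compact set under the proper map contains all pairs
    \<open>(h, x0)\<close> with \<open>h\<close> in \<open>B\<close>. Its projection to
    \<open>A\<close> is compact and contains the closed set \<open>B\<close>.\<close>
  have "compactin (prod_topology euclidean euclidean) (closure (ball x0 R) \<times> {x0})"
    by (simp add: compact_Times proper_metric)
  from compactin_proper_map_preimage[OF A_proper[unfolded acts_properly_def] this]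
  have "compactin (prod_topology (subtopology T A) euclidean)
      {p \<in> topspace (prod_topology (subtopology T A) euclidean).
        (case p of (h, x) \<Rightarrow> (\<phi> h x, x)) \<in> closure (ball x0 R) \<times> {x0}}" .
  from image_compactin[OF this continuous_map_fst]
  have "compactin (subtopology T A) B"
  proof (rule closed_compactin[OF _ _ B_closed])
    show "B \<subseteq> fst ` {p \<in> topspace (prod_topology (subtopology T A) euclidean).
        (case p of (h, x) \<Rightarrow> (\<phi> h x, x)) \<in> closure (ball x0 R) \<times> {x0}}"
    proof
      fix h assume h: "h \<in> B"
      have "(h, x0) \<in> {p \<in> topspace (prod_topology (subtopology T A) euclidean).
        (case p of (h, x) \<Rightarrow> (\<phi> h x, x)) \<in> closure (ball x0 R) \<times> {x0}}"
        using h B_sub Ac orbit[OF h] by (auto simp: topspace_eq)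
      then show "h \<in> fst ` {p \<in> topspace (prod_topology (subtopology T A) euclidean).
        (case p of (h, x) \<Rightarrow> (\<phi> h x, x)) \<in> closure (ball x0 R) \<times> {x0}}"
        by (rule rev_image_eqI) simp
    qed
  qed
  then have "B = {\<one>}"
    using A_no_compact[OF B_subgroup B_sub] by (simp add: compactin_subtopology)
  moreover obtain h where "h \<noteq> \<one>" "h \<in> A" "h \<in> N'"
    using A_acc N' unfolding in_derived_set_of by blast
  ultimately show False using N'_B by blast
qed

lemma no_thin_support:
  assumes S: "open S" and thin: "thin \<mu> k (indicator S)"
    and f0: "f0 \<in> supported S" "f0 \<noteq> 0"
    and A: "subgroup A G" and A_tau: "A \<subseteq> G_tau G \<phi> k" and A_proper: "acts_properly T \<phi> A"
    and A_acc: "\<one> \<in> T derived_set_of A"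
    and A_no_compact: "\<And>K. subgroup K G \<Longrightarrow> K \<subseteq> A \<Longrightarrow> compactin T K \<Longrightarrow> K = {\<one>}"
  shows False
proof -
  \<comment> \<open>\<open>f0\<close> is carried along because each enlargement needs a nonzero
    vector in the supported space.\<close>
  define P where "P \<Omega> \<longleftrightarrow> open \<Omega> \<and> thin \<mu> k (indicator \<Omega>) \<and> f0 \<in> supported \<Omega>" for \<Omega>
  define Q where "Q n \<Omega> \<Omega>' \<longleftrightarrow> \<Omega> \<subseteq> \<Omega>' \<and> supported \<Omega> \<subset> supported \<Omega>' 
    \<and> (\<forall>y. form (indicator (\<Omega>' - \<Omega>)) (k y) \<le> (1/2) ^ n)" for n :: nat and \<Omega> \<Omega>'
  have step: "\<exists>\<Omega>'. P \<Omega>' \<and> Q n \<Omega> \<Omega>'" if "P \<Omega>" for \<Omega> n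
  proof -
    have \<Omega>: "open \<Omega>" "thin \<mu> k (indicator \<Omega>)" "f0 \<in> supported \<Omega>" using that by (auto simp: P_def)
    obtain N where N: "openin T N" "\<one> \<in> N" 
      "\<And>h y. h \<in> N \<Longrightarrow> form (indicator (\<phi> h ` \<Omega> - \<Omega>)) (k y) < (1/2) ^ n"
      using form_translated_difference_small[OF \<Omega>(1,2), of "(1/2) ^ n"] by auto
    obtain h f where h: "h \<in> N" "h \<in> A" and f: "f \<in> supported \<Omega>" "translate h f \<notin> supported \<Omega>"
      using support_not_stable[OF \<Omega> f0(2) A A_tau A_proper A_acc A_no_compact N(1,2)] by blast
    have hc: "h \<in> carrier G" and ht: "h \<in> G_tau G \<phi> k"
      using h(2) A_tau by (auto simp: G_tau_def)
    have op: "open (\<phi> h ` \<Omega>)" by (rule open_action_image[OF hc \<Omega>(1)])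
    define \<Omega>' where "\<Omega>' = \<Omega> \<union> \<phi> h ` \<Omega>"
    have op': "open \<Omega>'" using \<Omega>(1) op by (auto simp: \<Omega>'_def)
    have sym: "symbol (indicator \<Omega>)" "symbol (indicator (\<phi> h ` \<Omega>))" "symbol (indicator \<Omega>')"
      using \<Omega>(1) op op' by (auto intro!: symbol_indicator)
    have le: "form (indicator \<Omega>') g \<le> form (indicator \<Omega>) g + form (indicator (\<phi> h ` \<Omega>)) g" for g
      by (rule form_add_le[OF sym(3,1,2)]) (simp add: \<Omega>'_def indicator_def)
    have thin': "thin \<mu> k (indicator \<Omega>')"
      unfolding thin_iff[OF sym(3)]
    proof (intro allI impI)
      fix z :: 'x and e :: real assume "e > 0"
      then have e2: "e / 2 > 0" by simp
      obtain R1 where R1: "\<And>y. R1 \<le> dist z y \<Longrightarrow> form (indicator \<Omega>) (k y) < e / 2"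
        using \<Omega>(2) e2 unfolding thin_iff[OF sym(1)] by metis
      obtain R2 where R2: "\<And>y. R2 \<le> dist z y \<Longrightarrow> form (indicator (\<phi> h ` \<Omega>)) (k y) < e / 2"
        using thin_action_image[OF hc \<Omega>(1,2)] e2 unfolding thin_iff[OF sym(2)] by metis
      show "\<exists>R. \<forall>y. R \<le> dist z y \<longrightarrow> form (indicator \<Omega>') (k y) < e"
      proof (intro exI[of _ "max R1 R2"] allI impI)
        fix y assume "max R1 R2 \<le> dist z y"
        then show "form (indicator \<Omega>') (k y) < e"
          using R1[of y] R2[of y] le[of "k y"] by linarith
      qed
    qed
    have sub: "supported \<Omega> \<subseteq> supported \<Omega>'" "supported (\<phi> h ` \<Omega>) \<subseteq> supported \<Omega>'"
      by (auto intro!: supported_mono simp: \<Omega>'_def)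
    have "\<Omega>' - \<Omega> = \<phi> h ` \<Omega> - \<Omega>" by (auto simp: \<Omega>'_def)
    then have "Q n \<Omega> \<Omega>'"
      unfolding Q_def using sub translate_supported[OF ht f(1)] f(2) N(3)[OF h(1)]
      by (auto simp: less_imp_le) (auto simp: \<Omega>'_def)
    moreover have "P \<Omega>'" using op' thin' sub \<Omega>(3) by (auto simp: P_def)
    ultimately show ?thesis by blast
  qed
  have "\<exists>\<Omega>. \<forall>n. P (\<Omega> n) \<and> Q n (\<Omega> n) (\<Omega> (Suc n))"
  proof (rule dependent_nat_choice)
    show "\<exists>\<Omega>. P \<Omega>" using S thin f0 by (auto simp: P_def)
    show "\<exists>\<Omega>'. P \<Omega>' \<and> Q n \<Omega> \<Omega>'" if "P \<Omega>" for \<Omega> n using step[OF that] .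
  qed
  then obtain \<Omega> where \<Omega>: "\<forall>n. P (\<Omega> n) \<and> Q n (\<Omega> n) (\<Omega> (Suc n))" ..
  have op: "open (\<Omega> n)" and th: "thin \<mu> k (indicator (\<Omega> n))" and inc: "\<Omega> n \<subseteq> \<Omega> (Suc n)"
    and strict: "supported (\<Omega> n) \<subset> supported (\<Omega> (Suc n))"
    and small: "form (indicator (\<Omega> (Suc n) - \<Omega> n)) (k y) \<le> (1/2) ^ n" for n y
    using spec[OF \<Omega>, of n] by (simp_all add: P_def Q_def)
  define U where "U = (\<Union>n. \<Omega> n)"
  have U: "open U" using op by (auto simp: U_def)
  have sym: "symbol (indicator (\<Omega> n))" "symbol (indicator (\<Omega> (Suc n) - \<Omega> n))" "symbol (indicator U)" for n
    using op U by (auto intro!: symbol_indicator)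
  \<comment> \<open>The two powers telescope: their difference is the sum of
    \<open>(1/2) ^ i\<close> for \<open>i\<close> from \<open>n\<close> to
    \<open>n + j - 1\<close>.\<close>
  have grow: "form (indicator (\<Omega> (n + j))) (k y) \<le> form (indicator (\<Omega> n)) (k y) + 2 * (1/2) ^ n - 2 * (1/2) ^ (n + j)" for n j y
  proof (induction j)
    case (Suc j)
    have "form (indicator (\<Omega> (n + Suc j))) (k y) 
        \<le> form (indicator (\<Omega> (n + j))) (k y) + form (indicator (\<Omega> (Suc (n + j)) - \<Omega> (n + j))) (k y)"
      by (rule form_add_le[OF sym(1,1,2)]) (simp add: indicator_def)
    also have "\<dots> \<le> form (indicator (\<Omega> n)) (k y) + 2 * (1/2) ^ n - 2 * (1/2) ^ (n + j) + (1/2) ^ (n + j)"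
      by (intro add_mono Suc.IH small)
    also have "\<dots> = form (indicator (\<Omega> n)) (k y) + 2 * (1/2) ^ n - 2 * (1/2) ^ (n + Suc j)" by simp
    finally show ?case .
  qed simp
  have "incseq \<Omega>" using inc by (rule incseq_SucI)
  have lim: "(\<lambda>m. form (indicator (\<Omega> m)) f) \<longlonglongrightarrow> form (indicator U) f" for f
    unfolding form_def
  proof (rule integral_dominated_convergence[OF _ _ frame_sq_integrable[of f]])
    show "(\<lambda>x. indicator U x * (cmod (cinner f (k x)))\<^sup>2) \<in> borel_measurable \<mu>"
      using form_integrable[OF sym(3)] by (rule borel_measurable_integrable)
    show "(\<lambda>x. indicator (\<Omega> m) x * (cmod (cinner f (k x)))\<^sup>2) \<in> borel_measurable \<mu>" for m
      using form_integrable[OF sym(1)] by (rule borel_measurable_integrable)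
    show "AE x in \<mu>. (\<lambda>m. indicator (\<Omega> m) x * (cmod (cinner f (k x)))\<^sup>2) \<longlonglongrightarrow> indicator U x * (cmod (cinner f (k x)))\<^sup>2"
      unfolding U_def by (intro AE_I2 tendsto_intros LIMSEQ_indicator_incseq \<open>incseq \<Omega>\<close>)
    show "AE x in \<mu>. norm (indicator (\<Omega> m) x * (cmod (cinner f (k x)))\<^sup>2) \<le> (cmod (cinner f (k x)))\<^sup>2" for m
      by (rule AE_I2) (simp add: indicator_def)
  qed
  \<comment> \<open>The error is uniform in \<open>y\<close>, which is why thinness of a single
    \<open>\<Omega> n\<close> passes to the union up to an arbitrarily small amount.\<close>
  have limit_le: "form (indicator U) (k y) \<le> form (indicator (\<Omega> n)) (k y) + 2 * (1/2) ^ n" for n y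
  proof (rule LIMSEQ_le_const2[OF LIMSEQ_ignore_initial_segment[OF lim, of n]])
    have "form (indicator (\<Omega> (j + n))) (k y) \<le> form (indicator (\<Omega> n)) (k y) + 2 * (1/2) ^ n" for j
    proof -
      have "0 \<le> 2 * (1/2 :: real) ^ (n + j)" by simp
      then show ?thesis using grow[of n j y] unfolding add.commute[of j n] by linarith
    qed
    then show "\<exists>N. \<forall>j\<ge>N. form (indicator (\<Omega> (j + n))) (k y) \<le> form (indicator (\<Omega> n)) (k y) + 2 * (1/2) ^ n"
      by blast
  qed
  have "thin \<mu> k (indicator U)"
    unfolding thin_iff[OF sym(3)]
  proof (intro allI impI)
    fix z :: 'x and e :: real assume "e > 0"
    then obtain n where n: "(1/2) ^ n < e / 4"
      using real_arch_pow_inv[of "e / 4" "1/2"] by auto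
    obtain R where R: "\<And>y. R \<le> dist z y \<Longrightarrow> form (indicator (\<Omega> n)) (k y) < e / 2"
      using th[of n] \<open>e > 0\<close> unfolding thin_iff[OF sym(1)] by (metis half_gt_zero)
    show "\<exists>R. \<forall>y. R \<le> dist z y \<longrightarrow> form (indicator U) (k y) < e"
    proof (intro exI[of _ R] allI impI)
      fix y assume "R \<le> dist z y"
      then show "form (indicator U) (k y) < e"
        using R[of y] limit_le[of y n] n by linarith
    qed
  qed
  moreover have "supported (\<Omega> n) \<subseteq> supported U" for n
    by (rule supported_mono) (auto simp: U_def)
  ultimately show False
    using no_increasing_chain[of U "\<lambda>n. supported (\<Omega> n)"] U strict 
    by (simp add: subspace_supported closed_supported)
qed

section \<open>From a failing lower bound to a vector with thin support\<close>

lemma form_scaleR: "form \<rho> (r *\<^sub>R f) = r\<^sup>2 * form \<rho> f"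
proof -
  have "\<rho> x * (cmod (cinner (r *\<^sub>R f) (k x)))\<^sup>2 = r\<^sup>2 * (\<rho> x * (cmod (cinner f (k x)))\<^sup>2)" for x
    by (simp add: cinner_scaleR_left norm_mult power_mult_distrib)
  then show ?thesis unfolding form_def by (simp only: integral_mult_right_zero)
qed

text \<open>Without a lower bound there are unit vectors whose complementary form tends to zero.
  Compactness gives a subsequence converging in norm, and the form vanishes at its limit, which is
  again a unit vector.\<close>

lemma kernel_of_complement:
  assumes \<sigma>: "symbol \<sigma>" "thin \<mu> k \<sigma>"
    and no_bound: "\<not> (\<exists>c>0. \<forall>f. c * (norm f)\<^sup>2 \<le> form (\<lambda>x. 1 - \<sigma> x) f)"
  shows "\<exists>f. f \<noteq> 0 \<and> form (\<lambda>x. 1 - \<sigma> x) f = 0"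
proof -
  note \<sigma>' = symbol_complement[OF \<sigma>(1)]
  have "\<exists>u. norm u = 1 \<and> form (\<lambda>x. 1 - \<sigma> x) u < inverse (real (Suc n))" for n
  proof -
    have "\<not> (\<forall>f. inverse (real (Suc n)) * (norm f)\<^sup>2 \<le> form (\<lambda>x. 1 - \<sigma> x) f)"
      using no_bound by (metis inverse_positive_iff_positive of_nat_0_less_iff zero_less_Suc)
    then obtain f where f: "form (\<lambda>x. 1 - \<sigma> x) f < inverse (real (Suc n)) * (norm f)\<^sup>2"
      by (auto simp: not_le)
    then have n0: "norm f > 0" using form_nonneg[OF \<sigma>', of f] by (cases "f = 0") auto
    have "form (\<lambda>x. 1 - \<sigma> x) ((1 / norm f) *\<^sub>R f) < inverse (real (Suc n))"
      unfolding form_scaleR using f n0 by (simp add: power_divide divide_less_eq)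
    moreover have "norm ((1 / norm f) *\<^sub>R f) = 1" using n0 by simp
    ultimately show ?thesis by blast
  qed
  then obtain u where u: "\<And>n. norm (u n) = 1" 
    "\<And>n. form (\<lambda>x. 1 - \<sigma> x) (u n) < inverse (real (Suc n))" by metis
  have null: "(\<lambda>n. form (\<lambda>x. 1 - \<sigma> x) (u n)) \<longlonglongrightarrow> 0"
  proof (rule tendsto_sandwich[OF _ _ tendsto_const LIMSEQ_inverse_real_of_nat])
    show "\<forall>\<^sub>F n in sequentially. 0 \<le> form (\<lambda>x. 1 - \<sigma> x) (u n)" by (simp add: form_nonneg[OF \<sigma>'])
    show "\<forall>\<^sub>F n in sequentially. form (\<lambda>x. 1 - \<sigma> x) (u n) \<le> inverse (real (Suc n))"
      using u(2) by (intro always_eventually allI less_imp_le)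
  qed
  obtain r l where r: "strict_mono (r :: nat \<Rightarrow> nat)" and l: "(u \<circ> r) \<longlonglongrightarrow> l"
    using convergent_subsequence[OF \<sigma>, of u 1, OF _ null] u(1) by auto
  have "(\<lambda>n. norm ((u \<circ> r) n)) \<longlonglongrightarrow> norm l" by (intro tendsto_intros l)
  then have "norm l = 1" using u(1) by (simp add: LIMSEQ_const_iff)
  moreover have "form (\<lambda>x. 1 - \<sigma> x) l \<le> 0"
  proof (rule LIMSEQ_le_const)
    have "(\<lambda>n. norm ((u \<circ> r) n - l)) \<longlonglongrightarrow> 0"
      using tendsto_norm[OF tendsto_diff[OF l tendsto_const[of l]]] by simp
    then have "(\<lambda>n. 2 * form (\<lambda>x. 1 - \<sigma> x) ((u \<circ> r) n) + 2 * (norm ((u \<circ> r) n - l))\<^sup>2) \<longlonglongrightarrow> 2 * 0 + 2 * 0\<^sup>2"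
      using LIMSEQ_subseq_LIMSEQ[OF null r] by (intro tendsto_intros) (simp_all add: o_def)
    then show "(\<lambda>n. 2 * form (\<lambda>x. 1 - \<sigma> x) ((u \<circ> r) n) + 2 * (norm ((u \<circ> r) n - l))\<^sup>2) \<longlonglongrightarrow> 0"
      by simp
    \<comment> \<open>The limit is written as \<open>u - (u - l)\<close>; the second part is
      controlled by its norm.\<close>
    have "form (\<lambda>x. 1 - \<sigma> x) l \<le> 2 * form (\<lambda>x. 1 - \<sigma> x) ((u \<circ> r) n) + 2 * (norm ((u \<circ> r) n - l))\<^sup>2" for n
      using form_diff_le[OF \<sigma>', of "(u \<circ> r) n" "(u \<circ> r) n - l"] form_le_norm[OF \<sigma>', of "(u \<circ> r) n - l"] by simp
    then show "\<exists>N. \<forall>n\<ge>N. form (\<lambda>x. 1 - \<sigma> x) l \<le> 2 * form (\<lambda>x. 1 - \<sigma> x) ((u \<circ> r) n) + 2 * (norm ((u \<circ> r) n - l))\<^sup>2"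
      by blast
  qed
  ultimately show ?thesis
    using form_nonneg[OF \<sigma>', of l] by (intro exI[of _ l]) auto
qed

text \<open>A vanishing complementary form forces \<open>\<sigma> = 1\<close> almost everywhere on
  the support, so \<open>\<sigma>\<close> dominates the indicator almost everywhere, which suffices
  to compare Berezin transforms.\<close>

lemma thin_essential_support:
  assumes \<sigma>: "symbol \<sigma>" "thin \<mu> k \<sigma>" and f: "form (\<lambda>x. 1 - \<sigma> x) f = 0"
  shows "thin \<mu> k (indicator {x. cinner f (k x) \<noteq> 0})"
proof -
  define S where "S = {x. cinner f (k x) \<noteq> 0}"
  have "open S"
    unfolding S_def by (intro open_Collect_neq frame_inner_continuous continuous_intros)
  then have S: "symbol (indicator S)" by (intro symbol_indicator) simp
  have "AE x in \<mu>. (1 - \<sigma> x) * (cmod (cinner f (k x)))\<^sup>2 = 0"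
    using f form_integrable[OF symbol_complement[OF \<sigma>(1)], of f] symbol_le_1[OF \<sigma>(1)]
    unfolding form_def by (subst (asm) integral_nonneg_eq_0_iff_AE) auto
  then have ae: "AE x in \<mu>. indicator S x \<le> \<sigma> x"
    by (rule AE_mp) (auto intro!: AE_I2 simp: S_def indicator_def symbol_nonneg[OF \<sigma>(1)])
  have "form (indicator S) (k y) \<le> form \<sigma> (k y)" for y
    unfolding form_def
  proof (rule integral_mono_AE[OF form_integrable[OF S] form_integrable[OF \<sigma>(1)]])
    show "AE x in \<mu>. indicator S x * (cmod (cinner (k y) (k x)))\<^sup>2 \<le> \<sigma> x * (cmod (cinner (k y) (k x)))\<^sup>2"
      using ae by eventually_elim (rule mult_right_mono, simp_all)
  qed
  then show ?thesis
    using thin_mono[OF S \<sigma>] by (simp add: S_def)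
qed

end

theorem theorem2:
  fixes G :: "('g, 'm) monoid_scheme" and T :: "'g topology"
    and \<phi> :: "'g \<Rightarrow> 'x::metric_space \<Rightarrow> 'x"
    and \<mu> :: "'x measure" and k :: "'x \<Rightarrow> 'h::chilbert_space"
    and w :: "'x \<Rightarrow> real" and M :: real
    and A :: "'g set" and \<sigma> :: "'x \<Rightarrow> real"
  assumes quantization: "berezin_quantization G T \<phi> \<mu> k"
    and w_measurable: "w \<in> borel_measurable \<mu>"
    and w_pos: "\<And>x. w x > 0"
    and M_pos: "M > 0"
    and schur_bound:
      "\<And>y. ennreal (inverse (w y)) *
             (\<integral>\<^sup>+x. ennreal (cmod (cinner (k x) (k y)) * w x) \<partial>\<mu>) \<le> ennreal M"
    and schur_decay:
      "((\<lambda>R::real. SUP y. ennreal (inverse (w y)) *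
             (\<integral>\<^sup>+x\<in>- ball y R. ennreal (cmod (cinner (k x) (k y)) * w x) \<partial>\<mu>)) \<longlongrightarrow> 0) at_top"
    and A_subgroup: "subgroup A G" and A_tau: "A \<subseteq> G_tau G \<phi> k"
    and A_abelian: "comm_group (G\<lparr>carrier := A\<rparr>)"
    and A_proper: "acts_properly T \<phi> A"
    and A_accumulates: "\<one>\<^bsub>G\<^esub> \<in> T derived_set_of A"
    and A_no_compact: "\<And>K. subgroup K G \<Longrightarrow> K \<subseteq> A \<Longrightarrow> compactin T K \<Longrightarrow> K = {\<one>\<^bsub>G\<^esub>}"
    and \<sigma>_range: "\<And>x. 0 \<le> \<sigma> x \<and> \<sigma> x \<le> 1"
    and \<sigma>_thin: "thin \<mu> k \<sigma>"
  shows "\<exists>c>0. \<forall>f. cinner (toeplitz \<mu> k (\<lambda>x. 1 - \<sigma> x) f) f \<ge> complex_of_real (c * (norm f)\<^sup>2)"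
proof -
  interpret berezin_quantization G T \<phi> \<mu> k by (rule quantization)
  interpret decaying_frame G T \<phi> \<mu> k w
  proof
    show "w \<in> borel_measurable \<mu>" by (rule w_measurable)
    show "w x > 0" for x by (rule w_pos)
    fix d :: real assume "d > 0"
    then have "\<forall>\<^sub>F R in at_top. (SUP y. ennreal (inverse (w y)) *
             (\<integral>\<^sup>+x\<in>- ball y R. ennreal (cmod (cinner (k x) (k y)) * w x) \<partial>\<mu>)) < ennreal d"
      by (intro order_tendstoD(2)[OF schur_decay]) simp
    then obtain R where "(SUP y. ennreal (inverse (w y)) *
             (\<integral>\<^sup>+x\<in>- ball y R. ennreal (cmod (cinner (k x) (k y)) * w x) \<partial>\<mu>)) < ennreal d"
      using eventually_happens'[OF trivial_limit_at_top_linorder] by fast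
    then show "\<exists>r. \<forall>y. ennreal (inverse (w y)) *
             (\<integral>\<^sup>+x\<in>- ball y r. ennreal (cmod (cinner (k x) (k y)) * w x) \<partial>\<mu>) \<le> ennreal d"
      by (intro exI[of _ R] allI) (meson SUP_upper UNIV_I less_imp_le order_trans)
  qed
  have \<sigma>: "symbol \<sigma>" using \<sigma>_range \<sigma>_thin by (simp add: symbol_def thin_def)
  have "\<exists>c>0. \<forall>f. c * (norm f)\<^sup>2 \<le> form (\<lambda>x. 1 - \<sigma> x) f"
  proof (rule ccontr)
    assume "\<not> ?thesis"
    then obtain f where f: "f \<noteq> 0" "form (\<lambda>x. 1 - \<sigma> x) f = 0"
      using kernel_of_complement[OF \<sigma> \<sigma>_thin] by blast
    show False
    proof (rule no_thin_support[OF _ _ _ f(1) A_subgroup A_tau A_proper A_accumulates A_no_compact])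
      show "open {x. cinner f (k x) \<noteq> 0}"
        by (intro open_Collect_neq frame_inner_continuous continuous_intros)
      show "thin \<mu> k (indicator {x. cinner f (k x) \<noteq> 0})"
        by (rule thin_essential_support[OF \<sigma> \<sigma>_thin f(2)])
      show "f \<in> supported {x. cinner f (k x) \<noteq> 0}" by (simp add: supported_def)
    qed
  qed
  \<comment> \<open>The order on complex numbers compares real parts and demands equal imaginary
    parts; here both sides are real.\<close>
  then show ?thesis
    by (simp add: cinner_toeplitz_self[OF symbol_complement[OF \<sigma>]] less_eq_complex_def)
qed

end
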